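(* Let $n\ge 1$, let $\mathbb{B}$ be the open unit ball of $\mathbb{C}^n$, let $u:\mathbb{B}\to\mathbb{C}$ be holomorphic, and let $\varphi=(\varphi_1,\dots,\varphi_n):\mathbb{B}\to\mathbb{B}$ be holomorphic. Then the following statements are equivalent. (i) The weighted composition operator $uC_\varphi: H^\infty\to\mathcal{B}$ is bounded. (ii) $u\in\mathcal{B}$ and $$\sup_{k\in\mathbb{N}}\ \sup_{\xi\in\partial\mathbb{B}}\ \|u\,\langle\varphi,\xi\rangle^k\|_{\beta}<\infty .$$ (iii) $u\in\mathcal{B}$ and $$\sup_{z\in\mathbb{B}}\,(1-|z|^2)\,|u(z)|\,\sqrt{H_{\varphi(z)}(\varphi'(z)z,\varphi'(z)z)}<\infty .$$ (iv) $u\in\mathcal{B}$ and $$\sup_{1\le i\le n}\ \sup_{w\in\mathbb{B}}\ \|uC_\varphi\phi_{\varphi(w),i}\|_{\beta}<\infty .$$ (v) $u\in\mathcal{B}$ and $$\sup_{k\in\mathbb{N}}\ \sup_{\xi\in\partial\mathbb{B}}\ \|I_u(\langle\varphi,\xi\rangle^k)\|_{\beta}<\infty .$$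
   Context: Here $\langle z,w\rangle=\sum_{j=1}^n z_j\overline{w_j}$ and $|z|=\langle z,z\rangle^{1/2}$ on $\mathbb{C}^n$; $\partial\mathbb{B}$ is the unit sphere; $\mathbb{N}=\{1,2,3,\dots\}$. $H(\mathbb{B})$ is the space of holomorphic functions $\mathbb{B}\to\mathbb{C}$. Radial derivative: for $f\in H(\mathbb{B})$, $\mathcal{R}f(z)=\sum_{j=1}^n z_j\frac{\partial f}{\partial z_j}(z)$. Bloch space: for $f\in H(\mathbb{B})$ put $\|f\|_{\beta}=\sup_{z\in\mathbb{B}}(1-|z|^2)|\mathcal{R}f(z)|\in[0,\infty]$. The Bloch space $\mathcal{B}$ is the set of $f\in H(\mathbb{B})$ with $\|f\|_\beta<\infty$, a Banach space with norm $\|f\|_{\mathcal{B}}=|f(0)|+\|f\|_\beta$. $H^\infty$ is the Banach space of bounded holomorphic functions on $\mathbb{B}$ with norm $\|f\|_\infty=\sup_{z\in\mathbb{B}}|f(z)|$. Weighted composition operator: $(uC_\varphi f)(z)=u(z)f(\varphi(z))$ for $f\in H(\mathbb{B})$. The statement that $uC_\varphi:H^\infty\to\mathcal{B}$ is bounded means that it maps $H^\infty$ into $\mathcal{B}$ and is a bounded linear operator. $\varphi'(z)=\left(\frac{\partial\varphi_i}{\partial z_j}(z)\right)_{1\le i,j\le n}$ is the Jacobian matrix of $\varphi$, and $\varphi'(z)z$ is the matrix applied to the column vector $z$. Bergman metric: for $z\in\mathbb{B}$, $v\in\mathbb{C}^n$, $$H_z(v,v)=\frac{n+1}{2}\,\frac{(1-|z|^2)|v|^2+|\langle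 v,z\rangle|^2}{(1-|z|^2)^2}.$$ $\langle\varphi,\xi\rangle^k$ denotes the function $z\mapsto\langle\varphi(z),\xi\rangle^k$. Automorphisms: for $a\in\mathbb{B}\setminus\{0\}$, $$\phi_a(z)=\frac{a-P_az-\sqrt{1-|a|^2}\,Q_az}{1-\langle z,a\rangle},\qquad P_az=\frac{\langle z,a\rangle}{|a|^2}a,\quad Q_az=z-P_az,$$ and $\phi_0(z)=-z$. Write $\phi_a=(\phi_{a,1},\dots,\phi_{a,n})$ for its components. For $f\in H(\mathbb{B})$, $$I_u(f)(z)=\int_0^1 u(tz)\,(\mathcal{R}f)(tz)\,\frac{dt}{t},\qquad z\in\mathbb{B}.$$ *)

theory Defs
  imports "HOL-Analysis.Analysis"
begin

text \<open>
  The space \<open>\<complex>\<^sup>n\<close> is \<^typ>\<open>complex ^ 'n\<close>, whose library norm is the Euclidean one, and the unit ball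
  is \<^term>\<open>ball 0 1\<close>. Functions on the ball are total functions; the spaces and norms below depend only on
  their values on the ball.
\<close>

definition herm :: "complex ^ 'n \<Rightarrow> complex ^ 'n \<Rightarrow> complex" where
  "herm z w = (\<Sum>j\<in>UNIV. z $ j * cnj (w $ j))"

text \<open>Complex differentiability on an open set: the derivative exists and is complex linear.\<close>

definition mholomorphic_on :: "(complex ^ 'n \<Rightarrow> complex) \<Rightarrow> (complex ^ 'n) set \<Rightarrow> bool" where
  "mholomorphic_on f S \<longleftrightarrow>
     (\<forall>z\<in>S. \<exists>c :: complex ^ 'n. (f has_derivative (\<lambda>v. \<Sum>j\<in>UNIV. c $ j * v $ j)) (at z))"

definition cpartial :: "'n \<Rightarrow> (complex ^ 'n \<Rightarrow> complex) \<Rightarrow> complex ^ 'n \<Rightarrow> complex" where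
  "cpartial j f z = deriv (\<lambda>t. f (z + axis j t)) 0"

definition radial_deriv :: "(complex ^ 'n \<Rightarrow> complex) \<Rightarrow> complex ^ 'n \<Rightarrow> complex" where
  "radial_deriv f z = (\<Sum>j\<in>UNIV. z $ j * cpartial j f z)"

definition cjacobian :: "(complex ^ 'n \<Rightarrow> complex ^ 'n) \<Rightarrow> complex ^ 'n \<Rightarrow> complex ^ 'n ^ 'n" where
  "cjacobian \<phi> z = (\<chi> i j. cpartial j (\<lambda>x. \<phi> x $ i) z)"

definition bloch_seminorm :: "(complex ^ 'n \<Rightarrow> complex) \<Rightarrow> ennreal" where
  "bloch_seminorm f =
     (SUP z\<in>ball 0 1. ennreal ((1 - (norm z)\<^sup>2) * cmod (radial_deriv f z)))"

definition bloch_space :: "(complex ^ 'n \<Rightarrow> complex) set" where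
  "bloch_space = {f. mholomorphic_on f (ball 0 1) \<and> bloch_seminorm f < \<infinity>}"

definition bloch_norm :: "(complex ^ 'n \<Rightarrow> complex) \<Rightarrow> ennreal" where
  "bloch_norm f = ennreal (cmod (f 0)) + bloch_seminorm f"

definition Hinf :: "(complex ^ 'n \<Rightarrow> complex) set" where
  "Hinf = {f. mholomorphic_on f (ball 0 1) \<and> bounded (f ` ball 0 1)}"

definition Hinf_norm :: "(complex ^ 'n \<Rightarrow> complex) \<Rightarrow> ennreal" where
  "Hinf_norm f = (SUP z\<in>ball 0 1. ennreal (cmod (f z)))"

definition bounded_linear_operator ::
  "('a \<Rightarrow> complex) set \<Rightarrow> (('a \<Rightarrow> complex) \<Rightarrow> ennreal) \<Rightarrow>
   ('b \<Rightarrow> complex) set \<Rightarrow> (('b \<Rightarrow> complex) \<Rightarrow> ennreal) \<Rightarrow>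
   (('a \<Rightarrow> complex) \<Rightarrow> 'b \<Rightarrow> complex) \<Rightarrow> bool" where
  "bounded_linear_operator V normV W normW T \<longleftrightarrow>
     (\<forall>f\<in>V. T f \<in> W) \<and>
     (\<forall>f\<in>V. \<forall>g\<in>V. T (\<lambda>x. f x + g x) = (\<lambda>y. T f y + T g y)) \<and>
     (\<forall>f\<in>V. \<forall>c. T (\<lambda>x. c * f x) = (\<lambda>y. c * T f y)) \<and>
     (\<exists>C::real. C \<ge> 0 \<and> (\<forall>f\<in>V. normW (T f) \<le> ennreal C * normV f))"

definition wcomp ::
  "(complex ^ 'n \<Rightarrow> complex) \<Rightarrow> (complex ^ 'n \<Rightarrow> complex ^ 'n) \<Rightarrow>
   (complex ^ 'n \<Rightarrow> complex) \<Rightarrow> complex ^ 'n \<Rightarrow> complex" where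
  "wcomp u \<phi> f = (\<lambda>z. u z * f (\<phi> z))"

text \<open>The diagonal values \<open>H\<^sub>z(v, v)\<close> of the Bergman metric.\<close>

definition bergman :: "complex ^ 'n \<Rightarrow> complex ^ 'n \<Rightarrow> real" where
  "bergman z v = (real CARD('n) + 1) / 2 *
     (((1 - (norm z)\<^sup>2) * (norm v)\<^sup>2 + (cmod (herm v z))\<^sup>2) / (1 - (norm z)\<^sup>2)\<^sup>2)"

definition ball_proj :: "complex ^ 'n \<Rightarrow> complex ^ 'n \<Rightarrow> complex ^ 'n" where
  "ball_proj a z = (herm z a / of_real ((norm a)\<^sup>2)) *s a"

definition ball_aut :: "complex ^ 'n \<Rightarrow> complex ^ 'n \<Rightarrow> complex ^ 'n" where
  "ball_aut a z =
     (if a = 0 then - z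
      else (1 / (1 - herm z a)) *s
        (a - ball_proj a z - sqrt (1 - (norm a)\<^sup>2) *\<^sub>R (z - ball_proj a z)))"

text \<open>
  For holomorphic \<open>u\<close> and \<open>f\<close> the integrand extends continuously to \<open>t = 0\<close>; its value there
  (zero, by the convention for division) does not affect the integral.
\<close>

definition I_op ::
  "(complex ^ 'n \<Rightarrow> complex) \<Rightarrow> (complex ^ 'n \<Rightarrow> complex) \<Rightarrow> complex ^ 'n \<Rightarrow> complex" where
  "I_op u f z =
     integral {0..1} (\<lambda>t::real. u (t *\<^sub>R z) * radial_deriv f (t *\<^sub>R z) / of_real t)"

end

theory Submission
  imports Defs "HOL-Complex_Analysis.Complex_Analysis"
begin

text \<open>
  Put \<open>N(w, v)\<^sup>2 = \<bar>\<langle>v,w\<rangle>\<bar>\<^sup>2/\<delta>\<^sup>2 + \<bar>v\<bar>\<^sup>2/\<delta>\<close> with \<open>\<delta> = 1 - \<bar>w\<bar>\<^sup>2\<close>; up to a constant factor this is the Bergman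
  metric. By the product and chain rules, and since \<open>u\<close> is a Bloch function, each of (i), (ii),
  (iv), (v) bounds \<open>(1 - \<bar>z\<bar>\<^sup>2) \<bar>u(z)\<bar> \<bar>df(V)\<bar>\<close>, where \<open>df\<close> is taken at \<open>\<phi>(z)\<close> and \<open>V = \<phi>'(z)z\<close>, uniformly over
  some family of test functions \<open>f\<close> in the unit ball of \<open>H\<^sup>\<infinity>\<close>; for condition (v) this is the identity
  \<open>R(I\<^sub>u f) = u Rf\<close>.

  Cauchy's estimate on the affine disc \<open>w + \<zeta>v\<close> of radius \<open>1/(4N)\<close>, which lies in the ball, gives
  \<open>\<bar>df(v)\<bar> \<le> 4 N(w, v)\<close> at \<open>w\<close> for all \<open>f\<close> in that unit ball, so (iii) implies the others. Conversely,
  the components of the automorphism \<open>\<phi>\<^sub>w\<close> recover \<open>N\<close> exactly, because its derivative at \<open>w\<close> maps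
  \<open>v\<close> to a vector of length \<open>N(w, v)\<close>; and among the powers \<open>\<langle>\<cdot>,\<xi>\<rangle>\<^sup>k\<close> one with \<open>k \<approx> 1/(2\<delta>)\<close> and \<open>\<xi>\<close>
  proportional to \<open>w + \<tau>v\<close>, \<open>\<bar>\<tau>v\<bar>\<^sup>2 = \<delta>\<close>, has derivative at least \<open>N/8\<close> at \<open>w\<close> in the direction \<open>v\<close>.
\<close>

subsection \<open>Complex derivatives in several variables\<close>

text \<open>Only complex homogeneity is recorded: additivity comes from
  \<open>has_derivative\<close>, whose derivatives are real linear.\<close>

definition clinear_form :: "(complex ^ 'n \<Rightarrow> complex) \<Rightarrow> bool" where
  "clinear_form D \<longleftrightarrow> (\<forall>c v. D (c *s v) = c * D v)"

text \<open>Building the differential from the coordinate partials makes it complex linear in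
  \<open>v\<close> at every point, differentiable or not. It agrees with the true derivative by
  \<open>cdiff_unique\<close>.\<close>

definition cdiff :: "(complex ^ 'n \<Rightarrow> complex) \<Rightarrow> complex ^ 'n \<Rightarrow> complex ^ 'n \<Rightarrow> complex" where
  "cdiff f z v = (\<Sum>j\<in>UNIV. cpartial j f z * v $ j)"

lemma scaleC_of_real: "complex_of_real r *s v = r *\<^sub>R v"
  by (simp add: vec_eq_iff complex_eq_iff)

lemma norm_scaleC [simp]: "norm (c *s v) = cmod c * norm (v :: complex ^ 'n)"
  by (simp add: norm_vec_def norm_mult L2_set_right_distrib)

lemma bounded_linear_scaleC_left: "bounded_linear (\<lambda>c. c *s (v :: complex ^ 'n))"
proof (rule bounded_linear_intro)
  show "norm (c *s v) \<le> norm c * norm v" for c by simp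
qed (simp_all add: vec_eq_iff algebra_simps)

lemma bounded_linear_scaleC_right: "bounded_linear (\<lambda>v :: complex ^ 'n. c *s v)"
proof (rule bounded_linear_intro)
  show "norm (c *s v) \<le> norm v * norm c" for v :: "complex ^ 'n" by simp
qed (simp_all add: vec_eq_iff algebra_simps)

lemma continuous_on_scaleC [continuous_intros]:
  fixes g :: "'a::topological_space \<Rightarrow> complex ^ 'n"
  assumes "continuous_on S f" "continuous_on S g"
  shows "continuous_on S (\<lambda>x. f x *s g x)"
  unfolding vector_scalar_mult_def using assms by (intro continuous_intros)

lemma axis_as_scaleC: "axis j t = (t :: complex) *s axis j 1"
  by (simp add: vec_eq_iff axis_def)

lemma cdiff_clinear [simp]: "clinear_form (cdiff f z)"
  by (simp add: clinear_form_def cdiff_def sum_distrib_left mult_ac)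

lemma cdiff_axis: "cdiff f z (axis j 1) = cpartial j f z"
  by (simp add: cdiff_def axis_def if_distrib cong: if_cong)

lemma radial_deriv_eq_cdiff: "radial_deriv f z = cdiff f z z"
  by (simp add: radial_deriv_def cdiff_def mult.commute)

text \<open>The real chain rule gives the derivative \<open>s\<close> to \<open>D (s *s v)\<close>;
  homogeneity makes this multiplication by \<open>D v\<close>, so one-variable complex analysis
  applies on the line.\<close>

lemma has_derivative_along_line:
  assumes "(f has_derivative D) (at (z + t *s v))" "clinear_form D"
  shows "((\<lambda>s. f (z + s *s v)) has_field_derivative D v) (at t)"
proof -
  have "((\<lambda>s. z + s *s v) has_derivative (\<lambda>s. s *s v)) (at t)"
    using bounded_linear_imp_has_derivative[OF bounded_linear_scaleC_left[of v]]
    by (auto intro!: derivative_eq_intros)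
  from has_derivative_compose[OF this] assms(1)
  have "((\<lambda>s. f (z + s *s v)) has_derivative (\<lambda>s. D (s *s v))) (at t)" by blast
  moreover have "(\<lambda>s. D (s *s v)) = (*) (D v)"
    using assms(2) by (auto simp: clinear_form_def fun_eq_iff mult.commute)
  ultimately show ?thesis by (simp add: has_field_derivative_def)
qed

text \<open>The coordinate lines identify the partials with \<open>D (axis j 1)\<close>, and the
  basis expansion then determines \<open>D\<close>. Later differentials are computed by exhibiting a
  homogeneous derivative and citing this fact.\<close>

lemma cdiff_unique:
  assumes D: "(f has_derivative D) (at z)" and c: "clinear_form D"
  shows "cdiff f z = D"
proof -
  have p: "cpartial j f z = D (axis j 1)" for j
  proof -
    have "((\<lambda>s. f (z + s *s axis j 1)) has_field_derivative D (axis j 1)) (at 0)"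
      by (rule has_derivative_along_line) (use D c in auto)
    then show ?thesis
      unfolding cpartial_def by (subst axis_as_scaleC) (rule DERIV_imp_deriv)
  qed
  have lin: "linear D" using D by (simp add: has_derivative_linear)
  show ?thesis
  proof
    fix v
    have "D v = D (\<Sum>i\<in>UNIV. (v $ i) *s axis i 1)" by (simp add: basis_expansion)
    also have "\<dots> = (\<Sum>i\<in>UNIV. D ((v $ i) *s axis i 1))" by (simp add: linear_sum[OF lin])
    also have "\<dots> = cdiff f z v"
      using c by (simp add: cdiff_def p clinear_form_def mult.commute)
    finally show "cdiff f z v = D v" by simp
  qed
qed

lemma mholomorphic_onI:
  assumes "\<And>z. z \<in> S \<Longrightarrow> \<exists>D. (f has_derivative D) (at z) \<and> clinear_form D"
  shows "mholomorphic_on f S"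
  unfolding mholomorphic_on_def
proof
  fix z assume "z \<in> S"
  then obtain D where D: "(f has_derivative D) (at z)" "clinear_form D" using assms by blast
  then have "(f has_derivative cdiff f z) (at z)" using cdiff_unique by blast
  moreover have "cdiff f z = (\<lambda>v. \<Sum>j\<in>UNIV. (\<chi> j. cpartial j f z) $ j * v $ j)"
    by (simp add: cdiff_def fun_eq_iff)
  ultimately show "\<exists>c. (f has_derivative (\<lambda>v. \<Sum>j\<in>UNIV. c $ j * v $ j)) (at z)" by metis
qed

lemma mholomorphic_on_has_derivative:
  assumes "mholomorphic_on f S" "z \<in> S"
  shows "(f has_derivative cdiff f z) (at z)"
proof -
  obtain c where c: "(f has_derivative (\<lambda>v. \<Sum>j\<in>UNIV. c $ j * v $ j)) (at z)"
    using assms unfolding mholomorphic_on_def by blast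
  have "clinear_form (\<lambda>v. \<Sum>j\<in>UNIV. c $ j * v $ j)"
    by (simp add: clinear_form_def sum_distrib_left mult_ac)
  from cdiff_unique[OF c this] c show ?thesis by simp
qed

lemma mholomorphic_on_continuous: "mholomorphic_on f S \<Longrightarrow> continuous_on S f"
  using mholomorphic_on_has_derivative has_derivative_continuous
  by (metis continuous_at_imp_continuous_on)

lemma mholomorphic_on_const: "mholomorphic_on (\<lambda>z. c) S"
  by (rule mholomorphic_onI) (auto intro!: exI[of _ "\<lambda>_. 0"] simp: clinear_form_def)

lemma mholomorphic_on_nth: "mholomorphic_on (\<lambda>z. z $ i) S"
  by (rule mholomorphic_onI)
    (auto intro!: exI[of _ "\<lambda>v. v $ i"] bounded_linear_imp_has_derivative bounded_linear_vec_nth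
      simp: clinear_form_def)

lemma cdiff_add:
  assumes "mholomorphic_on f S" "mholomorphic_on g S" "z \<in> S"
  shows "((\<lambda>x. f x + g x) has_derivative (\<lambda>v. cdiff f z v + cdiff g z v)) (at z)"
    "cdiff (\<lambda>x. f x + g x) z v = cdiff f z v + cdiff g z v"
proof -
  show "((\<lambda>x. f x + g x) has_derivative (\<lambda>v. cdiff f z v + cdiff g z v)) (at z)"
    by (rule has_derivative_add[OF mholomorphic_on_has_derivative[OF assms(1,3)]
          mholomorphic_on_has_derivative[OF assms(2,3)]])
  from cdiff_unique[OF this] show "cdiff (\<lambda>x. f x + g x) z v = cdiff f z v + cdiff g z v"
    using cdiff_clinear[of f z] cdiff_clinear[of g z]
    by (simp add: clinear_form_def algebra_simps)
qed

lemma cdiff_mult: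
  assumes "mholomorphic_on f S" "mholomorphic_on g S" "z \<in> S"
  shows "((\<lambda>x. f x * g x) has_derivative (\<lambda>v. f z * cdiff g z v + cdiff f z v * g z)) (at z)"
    "cdiff (\<lambda>x. f x * g x) z v = f z * cdiff g z v + cdiff f z v * g z"
proof -
  show "((\<lambda>x. f x * g x) has_derivative (\<lambda>v. f z * cdiff g z v + cdiff f z v * g z)) (at z)"
    by (rule has_derivative_mult[OF mholomorphic_on_has_derivative[OF assms(1,3)]
          mholomorphic_on_has_derivative[OF assms(2,3)]])
  from cdiff_unique[OF this]
  show "cdiff (\<lambda>x. f x * g x) z v = f z * cdiff g z v + cdiff f z v * g z"
    using cdiff_clinear[of f z] cdiff_clinear[of g z]
    by (simp add: clinear_form_def algebra_simps)
qed

lemma mholomorphic_on_add: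
  assumes "mholomorphic_on f S" "mholomorphic_on g S"
  shows "mholomorphic_on (\<lambda>x. f x + g x) S"
proof (rule mholomorphic_onI)
  fix z assume "z \<in> S"
  moreover have "clinear_form (\<lambda>v. cdiff f z v + cdiff g z v)"
    using cdiff_clinear[of f z] cdiff_clinear[of g z] by (simp add: clinear_form_def algebra_simps)
  ultimately show "\<exists>D. ((\<lambda>x. f x + g x) has_derivative D) (at z) \<and> clinear_form D"
    using cdiff_add(1)[OF assms] by blast
qed

lemma mholomorphic_on_mult:
  assumes "mholomorphic_on f S" "mholomorphic_on g S"
  shows "mholomorphic_on (\<lambda>x. f x * g x) S"
proof (rule mholomorphic_onI)
  fix z assume "z \<in> S"
  moreover have "clinear_form (\<lambda>v. f z * cdiff g z v + cdiff f z v * g z)"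
    using cdiff_clinear[of f z] cdiff_clinear[of g z] by (simp add: clinear_form_def algebra_simps)
  ultimately show "\<exists>D. ((\<lambda>x. f x * g x) has_derivative D) (at z) \<and> clinear_form D"
    using cdiff_mult(1)[OF assms] by blast
qed

lemma mholomorphic_on_sum:
  assumes "\<And>i. i \<in> I \<Longrightarrow> mholomorphic_on (f i) S"
  shows "mholomorphic_on (\<lambda>x. \<Sum>i\<in>I. f i x) S"
  using assms
  by (induction I rule: infinite_finite_induct)
    (auto intro: mholomorphic_on_const mholomorphic_on_add)

lemma mholomorphic_on_power: "mholomorphic_on f S \<Longrightarrow> mholomorphic_on (\<lambda>x. f x ^ k) S"
  by (induction k) (auto intro: mholomorphic_on_const mholomorphic_on_mult)

section \<open>Chain rules and restriction to complex lines\<close>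

lemma cdiff_compose_field:
  assumes f: "mholomorphic_on f S" and z: "z \<in> S" and g: "(g has_field_derivative g') (at (f z))"
  shows "((\<lambda>x. g (f x)) has_derivative (\<lambda>v. g' * cdiff f z v)) (at z)"
    "clinear_form (\<lambda>v. g' * cdiff f z v)" "cdiff (\<lambda>x. g (f x)) z v = g' * cdiff f z v"
proof -
  show 1: "((\<lambda>x. g (f x)) has_derivative (\<lambda>v. g' * cdiff f z v)) (at z)"
    using has_derivative_compose[OF mholomorphic_on_has_derivative[OF f z]] g
    unfolding has_field_derivative_def by blast
  show 2: "clinear_form (\<lambda>v. g' * cdiff f z v)"
    using cdiff_clinear[of f z] by (simp add: clinear_form_def algebra_simps)
  show "cdiff (\<lambda>x. g (f x)) z v = g' * cdiff f z v"
    using cdiff_unique[OF 1 2] by simp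
qed

lemma cdiff_compose:
  fixes \<phi> :: "complex ^ 'n \<Rightarrow> complex ^ 'm" and f :: "complex ^ 'm \<Rightarrow> complex"
  assumes \<phi>: "\<And>i. mholomorphic_on (\<lambda>z. \<phi> z $ i) S" and f: "mholomorphic_on f T"
    and z: "z \<in> S" and \<phi>z: "\<phi> z \<in> T"
  shows "((\<lambda>x. f (\<phi> x)) has_derivative (\<lambda>v. cdiff f (\<phi> z) (\<chi> i. cdiff (\<lambda>x. \<phi> x $ i) z v))) (at z)"
    "clinear_form (\<lambda>v. cdiff f (\<phi> z) (\<chi> i. cdiff (\<lambda>x. \<phi> x $ i) z v))"
    "cdiff (\<lambda>x. f (\<phi> x)) z v = cdiff f (\<phi> z) (\<chi> i. cdiff (\<lambda>x. \<phi> x $ i) z v)"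
proof -
  have ax: "bounded_linear (\<lambda>c :: complex. axis i c :: complex ^ 'm)" for i
    using bounded_linear_scaleC_left[of "axis i 1"] by (simp flip: axis_as_scaleC)
  \<comment> \<open>Holomorphy of \<open>\<phi>\<close> is given componentwise, so its vector
    derivative is assembled from the components placed on the axes.\<close>
  have "((\<lambda>x. \<Sum>i\<in>UNIV. axis i (\<phi> x $ i)) has_derivative
      (\<lambda>v. \<Sum>i\<in>UNIV. axis i (cdiff (\<lambda>x. \<phi> x $ i) z v))) (at z)"
    by (intro has_derivative_sum bounded_linear.has_derivative[OF ax]
        mholomorphic_on_has_derivative[OF \<phi> z])
  moreover have "(\<Sum>i\<in>UNIV. axis i (c i)) = (\<chi> i. c i)" for c :: "'m \<Rightarrow> complex"
    by (simp add: vec_eq_iff axis_def)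
  ultimately have "(\<phi> has_derivative (\<lambda>v. \<chi> i. cdiff (\<lambda>x. \<phi> x $ i) z v)) (at z)"
    by simp
  from has_derivative_compose[OF this mholomorphic_on_has_derivative[OF f \<phi>z]]
  show 1: "((\<lambda>x. f (\<phi> x)) has_derivative (\<lambda>v. cdiff f (\<phi> z) (\<chi> i. cdiff (\<lambda>x. \<phi> x $ i) z v))) (at z)" .
  show 2: "clinear_form (\<lambda>v. cdiff f (\<phi> z) (\<chi> i. cdiff (\<lambda>x. \<phi> x $ i) z v))"
    unfolding clinear_form_def
  proof (intro allI)
    fix c and v :: "complex ^ 'n"
    have "(\<chi> i. cdiff (\<lambda>x. \<phi> x $ i) z (c *s v)) = c *s (\<chi> i. cdiff (\<lambda>x. \<phi> x $ i) z v)"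
      by (simp add: vec_eq_iff cdiff_clinear[unfolded clinear_form_def])
    then show "cdiff f (\<phi> z) (\<chi> i. cdiff (\<lambda>x. \<phi> x $ i) z (c *s v)) =
        c * cdiff f (\<phi> z) (\<chi> i. cdiff (\<lambda>x. \<phi> x $ i) z v)"
      using cdiff_clinear[of f "\<phi> z"] by (simp add: clinear_form_def)
  qed
  show "cdiff (\<lambda>x. f (\<phi> x)) z v = cdiff f (\<phi> z) (\<chi> i. cdiff (\<lambda>x. \<phi> x $ i) z v)"
    using cdiff_unique[OF 1 2] by simp
qed

lemma mholomorphic_on_compose:
  fixes \<phi> :: "complex ^ 'n \<Rightarrow> complex ^ 'm"
  assumes "\<And>i. mholomorphic_on (\<lambda>z. \<phi> z $ i) S" "mholomorphic_on f T" "\<phi> ` S \<subseteq> T"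
  shows "mholomorphic_on (\<lambda>x. f (\<phi> x)) S"
  using cdiff_compose(1,2)[OF assms(1,2)] assms(3)
  by (intro mholomorphic_onI) blast

lemma mholomorphic_on_line:
  assumes f: "mholomorphic_on f S" and "\<And>t. t \<in> T \<Longrightarrow> z + t *s v \<in> S"
  shows "t \<in> T \<Longrightarrow> ((\<lambda>s. f (z + s *s v)) has_field_derivative cdiff f (z + t *s v) v) (at t)"
    "(\<lambda>s. f (z + s *s v)) holomorphic_on T"
proof -
  show *: "((\<lambda>s. f (z + s *s v)) has_field_derivative cdiff f (z + t *s v) v) (at t)" if "t \<in> T" for t
    using that assms by (intro has_derivative_along_line mholomorphic_on_has_derivative) auto
  show "(\<lambda>s. f (z + s *s v)) holomorphic_on T"
    unfolding holomorphic_on_def field_differentiable_def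
    using * has_field_derivative_at_within by blast
qed

subsection \<open>Cauchy formula and holomorphy of partial derivatives\<close>

text \<open>This is the one-variable Cauchy inequality at 0 for \<open>f (w + t *s v)\<close> on the
  disc of radius \<open>r\<close>.\<close>

lemma norm_cdiff_le:
  assumes f: "mholomorphic_on f S" and r: "0 < r"
    and sub: "\<And>t. cmod t \<le> r \<Longrightarrow> w + t *s v \<in> S" and K: "\<And>x. x \<in> S \<Longrightarrow> cmod (f x) \<le> K"
  shows "cmod (cdiff f w v) \<le> K / r"
proof -
  let ?h = "\<lambda>t. f (w + t *s v)"
  note l = mholomorphic_on_line[OF f, of "cball 0 r" w v]
  have h: "?h holomorphic_on cball 0 r" by (rule l(2)) (use sub in auto)
  have "cmod ((deriv ^^ 1) ?h 0) \<le> fact 1 * K / r ^ 1"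
    by (rule Cauchy_inequality) (use h r sub K in \<open>auto intro: holomorphic_on_imp_continuous_on holomorphic_on_subset\<close>)
  moreover have "(?h has_field_derivative cdiff f (w + 0 *s v) v) (at 0)"
    by (rule l(1)) (use sub r in auto)
  then have "deriv ?h 0 = cdiff f w v" by (simp add: DERIV_imp_deriv)
  ultimately show ?thesis by simp
qed

text \<open>Cauchy's formula over a fixed circle exhibits a partial derivative as an integral
  depending on the parameter \<open>z\<close>. Its continuity and holomorphy are then inherited from
  \<open>f\<close>.\<close>

lemma cpartial_integral:
  assumes f: "mholomorphic_on f S" and r: "0 < r"
    and sub: "\<And>t. cmod t \<le> r \<Longrightarrow> z + axis j t \<in> S"
  shows "cpartial j f z =
    integral {0..1} (\<lambda>t. 1 / (of_real r * exp (2 * of_real pi * \<i> * of_real t)) *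
       f (z + axis j (of_real r * exp (2 * of_real pi * \<i> * of_real t))))"
proof -
  let ?h = "\<lambda>t. f (z + t *s axis j 1)"
  have sub': "z + t *s axis j 1 \<in> S" if "cmod t \<le> r" for t
    using sub[OF that] by (simp flip: axis_as_scaleC)
  note l = mholomorphic_on_line[OF f, of "cball 0 r" z "axis j 1"]
  have h: "?h holomorphic_on cball 0 r" by (rule l(2)) (use sub' in auto)
  have "(?h has_field_derivative cdiff f (z + 0 *s axis j 1) (axis j 1)) (at 0)"
    by (rule l(1)) (use sub' r in auto)
  then have d: "deriv ?h 0 = cpartial j f z" by (simp add: DERIV_imp_deriv cdiff_axis)
  have "((\<lambda>u. ?h u / (u - 0) ^ Suc 1) has_contour_integral (2 * pi * \<i>) / fact 1 * (deriv ^^ 1) ?h 0)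
      (circlepath 0 r)"
    by (rule Cauchy_has_contour_integral_higher_derivative_circlepath)
      (use h r in \<open>auto intro: holomorphic_on_imp_continuous_on holomorphic_on_subset\<close>)
  then have "((\<lambda>t. ?h (circlepath 0 r t) / (circlepath 0 r t) ^ 2 *
      vector_derivative (circlepath 0 r) (at t within {0..1})) has_integral (2 * pi * \<i>) * cpartial j f z) {0..1}"
    by (simp add: has_contour_integral_def d power2_eq_square)
  \<comment> \<open>The velocity of the circle is \<open>2 * pi * \<i>\<close> times its position,
    which cancels one power of the squared denominator.\<close>
  then have "((\<lambda>t. (2 * pi * \<i>) * (1 / (of_real r * exp (2 * of_real pi * \<i> * of_real t)) *
       f (z + axis j (of_real r * exp (2 * of_real pi * \<i> * of_real t)))))
      has_integral (2 * pi * \<i>) * cpartial j f z) {0..1}"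
  proof (rule has_integral_eq[rotated])
    fix t :: real assume "t \<in> {0..1}"
    then have vd: "vector_derivative (circlepath 0 r) (at t within {0..1}) =
        2 * pi * \<i> * r * exp (2 * of_real pi * \<i> * t)"
      by (intro vector_derivative_circlepath01) auto
    show "?h (circlepath 0 r t) / (circlepath 0 r t) ^ 2 *
        vector_derivative (circlepath 0 r) (at t within {0..1}) =
      (2 * pi * \<i>) * (1 / (of_real r * exp (2 * of_real pi * \<i> * of_real t)) *
       f (z + axis j (of_real r * exp (2 * of_real pi * \<i> * of_real t))))"
      unfolding vd using r
      by (simp add: circlepath power2_eq_square flip: axis_as_scaleC)
  qed
  then have "((\<lambda>t. (1 / (of_real r * exp (2 * of_real pi * \<i> * of_real t)) *
       f (z + axis j (of_real r * exp (2 * of_real pi * \<i> * of_real t)))))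
      has_integral cpartial j f z) {0..1}"
    by (subst (asm) has_integral_mult_right_iff) auto
  then show ?thesis by (simp add: integral_unique)
qed

lemma norm_axis_complex [simp]: "norm (axis j (t :: complex)) = cmod t"
  by (simp add: norm_eq_sqrt_inner inner_axis_axis)

lemma continuous_on_axis [continuous_intros]:
  "continuous_on S f \<Longrightarrow> continuous_on S (\<lambda>x. axis j (f x :: complex))"
  by (subst axis_as_scaleC) (intro continuous_intros)

text \<open>One radius must serve all centres near \<open>z0\<close>, so that the contour in
  Cauchy's formula does not move with \<open>z\<close>.\<close>

lemma axis_disc_subset:
  fixes z0 :: "complex ^ 'n"
  assumes "open S" "z0 \<in> S"
  obtains r where "0 < r" "\<And>j z t. z \<in> ball z0 r \<Longrightarrow> cmod t \<le> r \<Longrightarrow> z + axis j t \<in> S"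
proof -
  obtain e where e: "0 < e" "ball z0 e \<subseteq> S" using assms openE by blast
  show thesis
  proof
    show "0 < e / 3" using e by simp
    fix j t and z assume zt: "z \<in> ball z0 (e / 3)" "cmod t \<le> e / 3"
    have "dist z0 (z + axis j t) \<le> dist z0 z + dist z (z + axis j t)" by (rule dist_triangle)
    also have "\<dots> < e" using zt e(1) by (simp add: dist_norm)
    finally show "z + axis j t \<in> S" using e(2) by auto
  qed
qed

text \<open>\<open>mholomorphic_on\<close> asks only for pointwise differentiability. Continuity of
  the partials is derived first because differentiation under the integral sign relies on
  it.\<close>

lemma cpartial_continuous:
  assumes f: "mholomorphic_on f S" and S: "open S"
  shows "continuous_on S (cpartial j f)"
proof (rule continuous_at_imp_continuous_on, rule ballI)
  fix z0 assume z0: "z0 \<in> S"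
  obtain r where r: "0 < r" and sub: "\<And>j z t. z \<in> ball z0 r \<Longrightarrow> cmod t \<le> r \<Longrightarrow> z + axis j t \<in> S"
    by (rule axis_disc_subset[OF S z0]) (rule that)
  let ?e = "\<lambda>t. complex_of_real r * exp (2 * of_real pi * \<i> * of_real t)"
  have "continuous_on (ball z0 r) (\<lambda>z. integral (cbox 0 1) (\<lambda>t. 1 / ?e t * f (z + axis j (?e t))))"
  proof (rule integral_continuous_on_param, unfold split_beta)
    show "continuous_on (ball z0 r \<times> cbox 0 1)
        (\<lambda>x. 1 / ?e (snd x) * f (fst x + axis j (?e (snd x))))"
      by (intro continuous_intros continuous_on_compose2[OF mholomorphic_on_continuous[OF f]])
        (use r in \<open>auto intro!: sub simp: norm_mult norm_exp\<close>)
  qed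
  then have "continuous_on (ball z0 r) (cpartial j f)"
    unfolding interval_cbox[symmetric]
    by (rule continuous_on_eq) (rule cpartial_integral[OF f r sub, symmetric])
  then show "isCont (cpartial j f) z0"
    using r by (simp add: continuous_on_eq_continuous_at)
qed

section \<open>Parameter integrals and holomorphy of the partial derivatives\<close>

lemma continuous_on_slice:
  assumes "continuous_on (U \<times> T) g" "x \<in> U"
  shows "continuous_on T (\<lambda>t. g (x, t))"
  by (rule continuous_on_compose2[OF assms(1)]) (use assms(2) in \<open>auto intro!: continuous_intros\<close>)

text \<open>Differentiation under the integral sign. The affine argument covers both applications:
  translates along a circle in Cauchy's formula, and dilates \<open>t z\<close> in the integral
  operator.\<close>

lemma mholomorphic_on_integral:
  fixes f :: "complex ^ 'n \<Rightarrow> complex" and \<alpha> K :: "real \<Rightarrow> complex"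
  assumes f: "mholomorphic_on f S" and S: "open S" and U: "open U" "convex U"
    and \<alpha>: "continuous_on {0..1} \<alpha>" and \<beta>: "continuous_on {0..1} \<beta>" and K: "continuous_on {0..1} K"
    and sub: "\<And>z t. z \<in> U \<Longrightarrow> t \<in> {0..1} \<Longrightarrow> \<alpha> t *s z + \<beta> t \<in> S"
  shows "mholomorphic_on (\<lambda>z. integral {0..1} (\<lambda>t. K t * f (\<alpha> t *s z + \<beta> t))) U"
proof (rule mholomorphic_onI)
  fix z assume z: "z \<in> U"
  define nth where "nth j = Blinfun (\<lambda>v :: complex ^ 'n. v $ j)" for j
  have nth: "blinfun_apply (nth j) v = v $ j" for j v
    unfolding nth_def by (simp add: bounded_linear_Blinfun_apply bounded_linear_vec_nth)
  \<comment> \<open>The Leibniz rule needs a continuous family of bounded linear maps; composing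
    scalar multiplications with coordinate projections reduces this continuity to that of the
    partials.\<close>
  define D where "D z t = (\<Sum>j\<in>UNIV. blinfun_mult_right (K t * \<alpha> t * cpartial j f (\<alpha> t *s z + \<beta> t)) o\<^sub>L nth j)"
    for z t
  have D: "blinfun_apply (D z t) v = K t * \<alpha> t * cdiff f (\<alpha> t *s z + \<beta> t) v" for z t v
    by (simp add: D_def blinfun.sum_left nth cdiff_def sum_distrib_left mult_ac)
  have \<alpha>': "continuous_on (U \<times> {0..1}) (\<lambda>x. \<alpha> (snd x))"
    by (rule continuous_on_compose2[OF \<alpha> continuous_on_snd[OF continuous_on_id]]) auto
  have \<beta>': "continuous_on (U \<times> {0..1}) (\<lambda>x. \<beta> (snd x))"
    by (rule continuous_on_compose2[OF \<beta> continuous_on_snd[OF continuous_on_id]]) auto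
  have K': "continuous_on (U \<times> {0..1}) (\<lambda>x. K (snd x))"
    by (rule continuous_on_compose2[OF K continuous_on_snd[OF continuous_on_id]]) auto
  have arg: "continuous_on (U \<times> {0..1}) (\<lambda>x. \<alpha> (snd x) *s fst x + \<beta> (snd x))"
    by (intro continuous_intros \<alpha>' \<beta>')
  have p: "continuous_on (U \<times> {0..1}) (\<lambda>x. cpartial j f (\<alpha> (snd x) *s fst x + \<beta> (snd x)))" for j
    by (rule continuous_on_compose2[OF cpartial_continuous[OF f S] arg]) (use sub in auto)
  have cf: "continuous_on (U \<times> {0..1}) (\<lambda>x. K (snd x) * f (\<alpha> (snd x) *s fst x + \<beta> (snd x)))"
    by (intro continuous_on_mult K' continuous_on_compose2[OF mholomorphic_on_continuous[OF f] arg])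
      (use sub in auto)
  have contD: "continuous_on (U \<times> cbox 0 1) (\<lambda>(z, t). D z t)"
    unfolding D_def split_beta interval_cbox[symmetric]
    by (intro continuous_on_sum bounded_bilinear.continuous_on[OF bounded_bilinear_blinfun_compose] continuous_on_const continuous_on_mult
        bounded_linear.continuous_on[OF bounded_linear_blinfun_mult_right] p \<alpha>' K')
  have "((\<lambda>z. integral (cbox 0 1) (\<lambda>t. K t * f (\<alpha> t *s z + \<beta> t))) has_derivative
      integral (cbox 0 1) (D z)) (at z within U)"
  proof (rule leibniz_rule[OF _ _ contD z U(2)])
    fix x and t :: real assume x: "x \<in> U" and t: "t \<in> cbox 0 1"
    have "((\<lambda>x. \<alpha> t *s x + \<beta> t) has_derivative (\<lambda>v. \<alpha> t *s v)) (at x)"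
      using bounded_linear_imp_has_derivative[OF bounded_linear_scaleC_right[of "\<alpha> t"]]
      by (auto intro!: derivative_eq_intros)
    moreover have "(f has_derivative cdiff f (\<alpha> t *s x + \<beta> t)) (at (\<alpha> t *s x + \<beta> t))"
      by (rule mholomorphic_on_has_derivative[OF f]) (use sub x t in auto)
    ultimately have "((\<lambda>x. f (\<alpha> t *s x + \<beta> t)) has_derivative
        (\<lambda>v. cdiff f (\<alpha> t *s x + \<beta> t) (\<alpha> t *s v))) (at x)"
      by (rule has_derivative_compose)
    then have "((\<lambda>x. K t * f (\<alpha> t *s x + \<beta> t)) has_derivative
        (\<lambda>v. K t * cdiff f (\<alpha> t *s x + \<beta> t) (\<alpha> t *s v))) (at x)"
      by (rule has_derivative_mult_right)
    moreover have "(\<lambda>v. K t * cdiff f (\<alpha> t *s x + \<beta> t) (\<alpha> t *s v)) = blinfun_apply (D x t)"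
      using cdiff_clinear[of f "\<alpha> t *s x + \<beta> t"] by (auto simp: D clinear_form_def fun_eq_iff)
    ultimately show "((\<lambda>x. K t * f (\<alpha> t *s x + \<beta> t)) has_derivative blinfun_apply (D x t)) (at x within U)"
      by (auto intro: has_derivative_at_withinI)
  next
    fix x assume x: "x \<in> U"
    show "(\<lambda>t. K t * f (\<alpha> t *s x + \<beta> t)) integrable_on cbox 0 1"
      using continuous_on_slice[OF cf x] by (simp add: integrable_continuous_real)
  qed
  then have "((\<lambda>z. integral {0..1} (\<lambda>t. K t * f (\<alpha> t *s z + \<beta> t))) has_derivative
      integral {0..1} (D z)) (at z)"
    unfolding at_within_open[OF z U(1)] box_real .
  moreover have "clinear_form (integral {0..1} (D z))"
  proof -
    have "D z integrable_on {0..1}"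
      using integrable_continuous[OF continuous_on_slice[OF contD z]] by (simp add: box_real)
    \<comment> \<open>Evaluation at \<open>v\<close> commutes with the integral, so homogeneity
      passes from each \<open>D z t\<close> to the integral.\<close>
    then have i: "blinfun_apply (integral {0..1} (D z)) v = integral {0..1} (\<lambda>t. D z t v)" for v
      by (rule blinfun_apply_integral)
    show ?thesis
      using cdiff_clinear[of f] by (simp add: clinear_form_def i D mult.left_commute)
  qed
  ultimately show "\<exists>D. ((\<lambda>z. integral {0..1} (\<lambda>t. K t * f (\<alpha> t *s z + \<beta> t))) has_derivative D) (at z)
      \<and> clinear_form D" by blast
qed

lemma mholomorphic_on_local:
  assumes "\<And>z. z \<in> S \<Longrightarrow> \<exists>U. z \<in> U \<and> mholomorphic_on f U"
  shows "mholomorphic_on f S"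
  using assms unfolding mholomorphic_on_def by blast

lemma mholomorphic_on_cong:
  assumes "mholomorphic_on f S" "open S" "\<And>z. z \<in> S \<Longrightarrow> f z = g z"
  shows "mholomorphic_on g S"
proof (rule mholomorphic_onI)
  fix z assume "z \<in> S"
  then have "(g has_derivative cdiff f z) (at z)"
    using has_derivative_transform_within_open[OF mholomorphic_on_has_derivative[OF assms(1)] assms(2) _ assms(3)]
    by blast
  then show "\<exists>D. (g has_derivative D) (at z) \<and> clinear_form D" by auto
qed

lemma mholomorphic_on_cpartial:
  assumes f: "mholomorphic_on f S" and S: "open S"
  shows "mholomorphic_on (cpartial j f) S"
proof (rule mholomorphic_on_local)
  fix z0 assume z0: "z0 \<in> S"
  obtain r where r: "0 < r" and sub: "\<And>j z t. z \<in> ball z0 r \<Longrightarrow> cmod t \<le> r \<Longrightarrow> z + axis j t \<in> S"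
    by (rule axis_disc_subset[OF S z0]) (rule that)
  let ?e = "\<lambda>t. complex_of_real r * exp (2 * of_real pi * \<i> * of_real t)"
  have "mholomorphic_on (\<lambda>z. integral {0..1} (\<lambda>t. 1 / ?e t * f (1 *s z + axis j (?e t)))) (ball z0 r)"
    by (rule mholomorphic_on_integral[OF f S])
      (use r in \<open>auto intro!: continuous_intros sub simp: norm_mult norm_exp\<close>)
  then have "mholomorphic_on (cpartial j f) (ball z0 r)"
    unfolding vector_smult_lid
    by (rule mholomorphic_on_cong[OF _ open_ball]) (rule cpartial_integral[OF f r sub, symmetric])
  then show "\<exists>U. z0 \<in> U \<and> mholomorphic_on (cpartial j f) U"
    using r by (intro exI[of _ "ball z0 r"]) auto
qed

subsection \<open>The radial derivative of the integral operator\<close>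

lemma scaleR_in_ball: "z \<in> ball (0 :: 'a::real_normed_vector) 1 \<Longrightarrow> t \<in> {0..1} \<Longrightarrow> t *\<^sub>R z \<in> ball 0 1"
  by (auto intro: le_less_trans[OF mult_left_le_one_le])

text \<open>For a linear form, \<open>df(tz)/t = df(z)\<close>: this removes the singularity of the integrand at \<open>t = 0\<close>.\<close>

lemma I_op_cdiff:
  "I_op u f z = integral {0..1} (\<lambda>t. u (t *\<^sub>R z) * cdiff f (t *\<^sub>R z) z)"
  unfolding I_op_def
proof (rule integral_spike[of "{0}"])
  fix t :: real assume t: "t \<in> {0..1} - {0}"
  have "cdiff f (t *\<^sub>R z) (t *\<^sub>R z) = of_real t * cdiff f (t *\<^sub>R z) z"
    using cdiff_clinear[of f "t *\<^sub>R z"] by (simp add: clinear_form_def flip: scaleC_of_real)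
  then show "u (t *\<^sub>R z) * cdiff f (t *\<^sub>R z) z =
      u (t *\<^sub>R z) * radial_deriv f (t *\<^sub>R z) / of_real t"
    using t by (simp add: radial_deriv_eq_cdiff)
qed simp

text \<open>Expanding the differential in coordinates moves the factors \<open>z $ j\<close> outside
  the integral and leaves parameter integrals of the holomorphic functions
  \<open>u x * cpartial j f x\<close>.\<close>

lemma mholomorphic_on_I_op:
  assumes u: "mholomorphic_on u (ball 0 1)" and f: "mholomorphic_on f (ball 0 1)"
  shows "mholomorphic_on (I_op u f) (ball 0 1)"
proof -
  define q where "q j x = u x * cpartial j f x" for j x
  have q: "mholomorphic_on (q j) (ball 0 1)" for j
    unfolding q_def by (intro mholomorphic_on_mult mholomorphic_on_cpartial u f open_ball)
  have sub: "of_real t *s z + 0 \<in> ball 0 1"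
    if "z \<in> ball 0 1" "t \<in> {0..1}" for t and z :: "complex ^ 'a"
    using scaleR_in_ball[OF that] by (simp add: scaleC_of_real)
  have "mholomorphic_on (\<lambda>z. integral {0..1} (\<lambda>t. 1 * q j (of_real t *s z + 0))) (ball 0 1)" for j
    by (rule mholomorphic_on_integral[OF q open_ball open_ball convex_ball])
      (intro continuous_intros | rule sub)+
  then have "mholomorphic_on (\<lambda>z. integral {0..1} (\<lambda>t. q j (t *\<^sub>R z))) (ball 0 1)" for j
    by (simp add: scaleC_of_real)
  then have "mholomorphic_on (\<lambda>z. \<Sum>j\<in>UNIV. z $ j * integral {0..1} (\<lambda>t. q j (t *\<^sub>R z))) (ball 0 1)"
    by (intro mholomorphic_on_sum mholomorphic_on_mult mholomorphic_on_nth)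
  then show ?thesis
  proof (rule mholomorphic_on_cong[OF _ open_ball])
    fix z :: "complex ^ 'a" assume z: "z \<in> ball 0 1"
    have "(\<lambda>t. q j (t *\<^sub>R z)) integrable_on {0..1}" for j
      by (intro integrable_continuous_real continuous_on_compose2[OF mholomorphic_on_continuous[OF q]]
          continuous_intros image_subsetI scaleR_in_ball[OF z])
    then have "(\<Sum>j\<in>UNIV. z $ j * integral {0..1} (\<lambda>t. q j (t *\<^sub>R z))) =
        integral {0..1} (\<lambda>t. \<Sum>j\<in>UNIV. z $ j * q j (t *\<^sub>R z))"
      by (subst integral_sum) (auto intro: integrable_on_mult_right)
    also have "\<dots> = I_op u f z"
      by (simp add: I_op_cdiff q_def cdiff_def sum_distrib_left mult_ac)
    finally show "(\<Sum>j\<in>UNIV. z $ j * integral {0..1} (\<lambda>t. q j (t *\<^sub>R z))) = I_op u f z" .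
  qed
qed

text \<open>Along the ray through \<open>z\<close> the operator is the antiderivative of
  \<open>p\<close>, so the fundamental theorem of calculus at \<open>s = 1\<close> gives the
  value.\<close>

lemma radial_deriv_I_op:
  assumes u: "mholomorphic_on u (ball 0 1)" and f: "mholomorphic_on f (ball 0 1)" and z: "z \<in> ball 0 1"
  shows "radial_deriv (I_op u f) z = u z * radial_deriv f z"
proof -
  define p where "p t = u (t *\<^sub>R z) * cdiff f (t *\<^sub>R z) z" for t
  have cont: "continuous_on {0..1} p"
    unfolding p_def cdiff_def
    by (intro continuous_on_mult continuous_on_sum continuous_on_const
        continuous_on_compose2[OF mholomorphic_on_continuous[OF u]]
        continuous_on_compose2[OF cpartial_continuous[OF f open_ball]]
        continuous_on_scaleR continuous_on_id image_subsetI scaleR_in_ball[OF z])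
  have line: "I_op u f (s *\<^sub>R z) = integral {0..s} p" if s: "s \<in> {0..1}" for s
  proof (cases "s = 0")
    case True
    have "cdiff f x 0 = 0" for x by (simp add: cdiff_def)
    with True show ?thesis by (simp add: I_op_cdiff)
  next
    case False
    \<comment> \<open>For \<open>s > 0\<close>, replacing \<open>t\<close> by \<open>s * t\<close>
      turns \<open>{0..s}\<close> into \<open>{0..1}\<close>; the resulting factor \<open>s\<close>
      is absorbed into the vector argument of the differential.\<close>
    have "(p has_integral integral {0..s} p) (cbox 0 s)"
      unfolding box_real using s
      by (intro integrable_integral integrable_continuous_real continuous_on_subset[OF cont]) auto
    from has_integral_affinity'[OF this, of s 0] s False
    have "((\<lambda>t. p (s * t)) has_integral integral {0..s} p / of_real s) {0..1}"
      by (simp add: box_real scaleR_conv_of_real divide_inverse mult.commute)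
    from has_integral_mult_right[OF this, of "of_real s"] False
    have "((\<lambda>t. of_real s * p (s * t)) has_integral integral {0..s} p) {0..1}" by simp
    moreover have "of_real s * p (s * t) = u (t *\<^sub>R s *\<^sub>R z) * cdiff f (t *\<^sub>R s *\<^sub>R z) (s *\<^sub>R z)" for t
      using cdiff_clinear[of f "t *\<^sub>R s *\<^sub>R z"]
      by (simp add: p_def clinear_form_def mult_ac flip: scaleC_of_real[of s z])
        (simp add: scaleC_of_real mult_ac)
    ultimately show ?thesis by (simp add: I_op_cdiff integral_unique)
  qed
  \<comment> \<open>Only the left derivative at the endpoint 1 is used. The fundamental theorem
    gives \<open>p 1\<close>, the chain rule gives \<open>cdiff (I_op u f) z z\<close>, and
    derivatives within \<open>{0..1}\<close> are unique.\<close>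
  have "((\<lambda>s. integral {0..s} p) has_vector_derivative p 1) (at 1 within {0..1})"
    by (rule integral_has_vector_derivative[OF cont]) simp
  then have 1: "((\<lambda>s. I_op u f (s *\<^sub>R z)) has_vector_derivative p 1) (at 1 within {0..1})"
    by (rule has_vector_derivative_transform[rotated 2]) (simp_all add: line)
  have "((\<lambda>s. s *\<^sub>R z) has_derivative (\<lambda>s. s *\<^sub>R z)) (at 1 within {0..1::real})"
    by (intro bounded_linear_imp_has_derivative bounded_linear_scaleR_left)
  moreover have D: "(I_op u f has_derivative cdiff (I_op u f) z) (at (1 *\<^sub>R z))"
    using mholomorphic_on_has_derivative[OF mholomorphic_on_I_op[OF u f] z] by simp
  ultimately have "((\<lambda>s. I_op u f (s *\<^sub>R z)) has_derivative (\<lambda>s. cdiff (I_op u f) z (s *\<^sub>R z)))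
      (at 1 within {0..1})"
    by (rule has_derivative_compose)
  then have "((\<lambda>s. I_op u f (s *\<^sub>R z)) has_vector_derivative cdiff (I_op u f) z z) (at 1 within {0..1})"
    unfolding has_vector_derivative_def
    using has_derivative_linear[OF D] by (simp add: linear_scale)
  from vector_derivative_unique_within[OF _ this 1]
  have "cdiff (I_op u f) z z = p 1"
    by (simp add: trivial_limit_within islimpt_Icc)
  then show ?thesis by (simp add: radial_deriv_eq_cdiff p_def)
qed

subsection \<open>The Bergman metric and powers of the Hermitian form\<close>

lemma herm_add_left: "herm (x + y) w = herm x w + herm y w"
  by (simp add: herm_def sum.distrib algebra_simps)

lemma herm_add_right: "herm w (x + y) = herm w x + herm w y"
  by (simp add: herm_def sum.distrib algebra_simps)

lemma herm_scaleC_left: "herm (c *s x) w = c * herm x w"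
  by (simp add: herm_def sum_distrib_left mult_ac)

lemma herm_scaleC_right: "herm x (c *s w) = cnj c * herm x w"
  by (simp add: herm_def sum_distrib_left mult_ac)

lemma herm_commute: "herm x y = cnj (herm y x)"
  by (simp add: herm_def mult.commute)

lemma herm_self: "herm x x = of_real ((norm x)\<^sup>2)"
  by (simp add: herm_def norm_vec_def L2_set_def sum_nonneg flip: complex_norm_square)

lemma inner_eq_Re_herm: "x \<bullet> y = Re (herm x y)"
  by (simp add: inner_vec_def herm_def inner_complex_def)

lemma norm_add_sq: "(norm (x + y))\<^sup>2 = (norm x)\<^sup>2 + 2 * Re (herm x y) + (norm (y :: complex ^ 'n))\<^sup>2"
  by (simp add: power2_norm_eq_inner inner_add_left inner_add_right inner_commute[of y x]
      flip: inner_eq_Re_herm)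

lemma norm_herm_le: "cmod (herm x y) \<le> norm x * norm y"
proof (cases "herm x y = 0")
  case False
  \<comment> \<open>This unimodular factor makes the Hermitian product real and nonnegative,
    reducing the claim to the real Cauchy-Schwarz inequality.\<close>
  define c where "c = cnj (herm x y) / cmod (herm x y)"
  have "herm (c *s x) y = (cnj (herm x y) * herm x y) / cmod (herm x y)"
    by (simp add: herm_scaleC_left c_def)
  also have "\<dots> = of_real (cmod (herm x y))"
    using False by (simp add: mult.commute[of "cnj _"] power2_eq_square flip: complex_norm_square)
  finally have "cmod (herm x y) = (c *s x) \<bullet> y" by (simp add: inner_eq_Re_herm)
  also have "\<dots> \<le> norm (c *s x) * norm y" by (rule norm_cauchy_schwarz)
  also have "norm (c *s x) = norm x" using False by (simp add: c_def norm_divide)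
  finally show ?thesis .
qed simp

lemma mholomorphic_on_herm: "mholomorphic_on (\<lambda>z. herm z w) S"
  unfolding herm_def
  by (intro mholomorphic_on_sum mholomorphic_on_mult mholomorphic_on_nth mholomorphic_on_const)

lemma bounded_linear_herm_left: "bounded_linear (\<lambda>z. herm z w)"
  by (rule bounded_linear_intro[of _ "norm w"])
    (auto simp: herm_add_left herm_scaleC_left norm_herm_le simp flip: scaleC_of_real,
     simp add: herm_scaleC_left scaleR_conv_of_real)

lemma cdiff_herm: "cdiff (\<lambda>z. herm z w) z = (\<lambda>v. herm v w)"
  by (rule cdiff_unique[OF bounded_linear_imp_has_derivative[OF bounded_linear_herm_left]])
    (simp add: clinear_form_def herm_scaleC_left)

lemma cdiff_herm_power: "cdiff (\<lambda>z. herm z w ^ k) z v = of_nat k * herm z w ^ (k - 1) * herm v w"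
proof -
  have "((\<lambda>x. x ^ k) has_field_derivative of_nat k * herm z w ^ (k - 1)) (at (herm z w))"
    by (auto intro!: derivative_eq_intros)
  from cdiff_compose_field(3)[OF mholomorphic_on_herm UNIV_I this] show ?thesis
    by (simp add: cdiff_herm)
qed

section \<open>The Bergman length without its dimensional factor, and upper and lower derivative
  bounds\<close>

definition berg_norm :: "complex ^ 'n \<Rightarrow> complex ^ 'n \<Rightarrow> real" where
  "berg_norm w v = sqrt ((1 - (norm w)\<^sup>2) * (norm v)\<^sup>2 + (cmod (herm v w))\<^sup>2) / (1 - (norm w)\<^sup>2)"

lemma one_minus_norm_sq_pos: "w \<in> ball 0 1 \<Longrightarrow> 0 < 1 - (norm w)\<^sup>2"
  by (simp add: power_less_one_iff abs_square_less_1)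

lemma sqrt_bergman:
  fixes w v :: "complex ^ 'n"
  assumes "w \<in> ball 0 1"
  shows "sqrt (bergman w v) = sqrt ((real CARD('n) + 1) / 2) * berg_norm w v"
  using one_minus_norm_sq_pos[OF assms]
  by (simp add: bergman_def berg_norm_def real_sqrt_mult real_sqrt_divide)

lemma berg_norm_nonneg: "w \<in> ball 0 1 \<Longrightarrow> 0 \<le> berg_norm w v"
  using one_minus_norm_sq_pos[of w] by (simp add: berg_norm_def)

lemma berg_norm_sq:
  assumes "w \<in> ball 0 1"
  shows "((1 - (norm w)\<^sup>2) * berg_norm w v)\<^sup>2 = (1 - (norm w)\<^sup>2) * (norm v)\<^sup>2 + (cmod (herm v w))\<^sup>2"
  using one_minus_norm_sq_pos[OF assms] by (simp add: berg_norm_def)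

lemma norm_cdiff_le_berg_norm:
  assumes f: "mholomorphic_on f (ball 0 1)" and K: "\<And>x. x \<in> ball 0 1 \<Longrightarrow> cmod (f x) \<le> K"
    and w: "w \<in> ball 0 1"
  shows "cmod (cdiff f w v) \<le> 4 * K * berg_norm w v"
proof -
  define d where "d = 1 - (norm w)\<^sup>2"
  define N where "N = berg_norm w v"
  define h where "h = cmod (herm v w)"
  have d: "0 < d" unfolding d_def by (rule one_minus_norm_sq_pos[OF w])
  have N0: "0 \<le> N" unfolding N_def by (rule berg_norm_nonneg[OF w])
  have sq: "(d * N)\<^sup>2 = d * (norm v)\<^sup>2 + h\<^sup>2"
    unfolding d_def N_def h_def by (rule berg_norm_sq[OF w])
  show ?thesis
  proof (cases "N = 0")
    case True
    then have "d * (norm v)\<^sup>2 + h\<^sup>2 = 0" using sq by simp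
    then have "d * (norm v)\<^sup>2 = 0"
      using d by (smt (verit) mult_nonneg_nonneg zero_le_power2)
    then have "v = 0" using d by simp
    then show ?thesis using True by (simp add: cdiff_def N_def)
  next
    case False
    then have N: "0 < N" using N0 by simp
    \<comment> \<open>Since \<open>h \<le> d * N\<close> and the squared norm of \<open>v\<close> is
      at most \<open>d\<close> times the square of \<open>N\<close>, the cross term adds at most
      \<open>d/2\<close> and the quadratic term at most \<open>d/16\<close> to the squared norm of
      \<open>w\<close>. The disc therefore stays in the ball.\<close>
    define r where "r = 1 / (4 * N)"
    have r: "0 < r" using N by (simp add: r_def)
    have "h\<^sup>2 \<le> (d * N)\<^sup>2" using sq d by simp
    then have h: "h \<le> d * N" using d N by (simp add: abs_le_square_iff[symmetric] h_def)
    have "d * (norm v)\<^sup>2 \<le> d * (d * N\<^sup>2)"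
      using sq by (simp add: power2_eq_square algebra_simps)
    then have nv: "(norm v)\<^sup>2 \<le> d * N\<^sup>2" using d by simp
    have "cmod (cdiff f w v) \<le> K / r"
    proof (rule norm_cdiff_le[OF f r _ K])
      fix t assume t: "cmod t \<le> r"
      have "(norm (w + t *s v))\<^sup>2 = (norm w)\<^sup>2 + 2 * Re (herm w (t *s v)) + (cmod t * norm v)\<^sup>2"
        by (simp add: norm_add_sq)
      also have "Re (herm w (t *s v)) \<le> cmod (herm w (t *s v))" by (rule complex_Re_le_cmod)
      also have "cmod (herm w (t *s v)) = cmod t * h"
        by (simp add: herm_scaleC_right norm_mult h_def herm_commute[of w v])
      also have "cmod t * h \<le> r * (d * N)"
        using t h r by (intro mult_mono) (auto simp: h_def)
      also have "r * (d * N) = d / 4" using N by (simp add: r_def)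
      also have "(cmod t * norm v)\<^sup>2 \<le> r\<^sup>2 * (d * N\<^sup>2)"
        unfolding power_mult_distrib using t nv by (intro mult_mono power_mono) auto
      also have "r\<^sup>2 * (d * N\<^sup>2) = d / 16" using N by (simp add: r_def power2_eq_square)
      finally have "(norm (w + t *s v))\<^sup>2 < 1" using d by (simp add: d_def field_simps)
      then show "w + t *s v \<in> ball 0 1" by (simp add: abs_square_less_1)
    qed
    then show ?thesis using N by (simp add: r_def N_def mult_ac)
  qed
qed

text \<open>The derivative is \<open>k * herm w \<xi> ^ (k - 1) * herm v \<xi>\<close>. A unit
  vector near the direction of \<open>w\<close>, tilted towards \<open>v\<close>, keeps both
  Hermitian products large, and \<open>k\<close> of order \<open>1/d\<close> balances the power
  against the factor \<open>k\<close>.\<close>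

lemma berg_norm_le_herm_powers:
  fixes w v :: "complex ^ 'n"
  assumes w: "w \<in> ball 0 1" and Q: "0 \<le> Q"
    and bd: "\<And>k \<xi>. 1 \<le> k \<Longrightarrow> \<xi> \<in> sphere 0 1 \<Longrightarrow> Q * cmod (cdiff (\<lambda>z. herm z \<xi> ^ k) w v) \<le> C"
  shows "Q * berg_norm w v \<le> 8 * C"
proof (cases "v = 0")
  case True
  \<comment> \<open>Any unit vector will do: the hypothesis \<open>bd\<close> applied to it yields
    \<open>0 \<le> C\<close>.\<close>
  obtain \<xi> :: "complex ^ 'n" where "\<xi> \<in> sphere 0 1"
    using vector_choose_size[of 1] by (auto simp: dist_norm)
  from bd[OF order_refl this] have "0 \<le> C" using Q by (smt (verit) mult_nonneg_nonneg norm_ge_zero)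
  then show ?thesis using True by (simp add: berg_norm_def herm_def)
next
  case False
  define d where "d = 1 - (norm w)\<^sup>2"
  define N where "N = berg_norm w v"
  define h where "h = herm v w"
  define e where "e = (if h = 0 then 1 else h / cmod h)"
  \<comment> \<open>This gives \<open>b *\<^sub>R v\<close> squared length \<open>d\<close>, exactly
    what the squared norm of \<open>w\<close> lacks to reach 1.\<close>
  define b where "b = sqrt d / norm v"
  define s where "s = b * cmod h"
  have d: "0 < d" "d \<le> 1" using one_minus_norm_sq_pos[OF w] by (auto simp: d_def)
  have N0: "0 \<le> N" unfolding N_def by (rule berg_norm_nonneg[OF w])
  have e: "cmod e = 1" "h = cmod h * e" by (auto simp: e_def norm_divide)
  have ee: "e * cnj e = 1" using e(1) by (simp flip: complex_norm_square)
  have b: "0 \<le> b" "b * norm v = sqrt d" using False d by (auto simp: b_def)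
  \<comment> \<open>The phase \<open>cnj e\<close> aligns the two summands of \<open>herm v \<xi>\<^sub>0\<close> and makes \<open>herm w \<xi>\<^sub>0\<close> a positive real.\<close>
  define \<xi>\<^sub>0 where "\<xi>\<^sub>0 = w + (b * cnj e) *s v"
  have vv: "b * (norm v)\<^sup>2 = sqrt d * norm v" using b(2) by (simp add: power2_eq_square flip: mult.assoc)
  have hv: "herm v \<xi>\<^sub>0 = e * of_real (cmod h + sqrt d * norm v)"
  proof -
    have "herm v \<xi>\<^sub>0 = h + e * of_real (b * (norm v)\<^sup>2)"
      by (simp add: \<xi>\<^sub>0_def herm_add_right herm_scaleC_right h_def herm_self)
    then show ?thesis by (subst (asm) e(2)) (simp add: vv algebra_simps)
  qed
  have hb: "herm w ((b * cnj e) *s v) = of_real s"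
  proof -
    have "herm w ((b * cnj e) *s v) = of_real b * e * cnj h"
      by (simp add: herm_scaleC_right h_def herm_commute[of w v])
    also have "\<dots> = of_real b * (e * cnj e) * of_real (cmod h)"
      by (subst e(2)) simp
    finally show ?thesis by (simp add: ee s_def)
  qed
  have hw: "herm w \<xi>\<^sub>0 = of_real (1 - d + s)"
    by (simp add: \<xi>\<^sub>0_def herm_add_right hb herm_self d_def)
  have n0: "(norm \<xi>\<^sub>0)\<^sup>2 = 1 + 2 * s"
  proof -
    have "(norm ((b * cnj e) *s v))\<^sup>2 = d"
      using b d e(1) by (simp add: norm_mult)
    then show ?thesis by (simp add: \<xi>\<^sub>0_def norm_add_sq hb d_def)
  qed
  have s0: "0 \<le> s" using b by (simp add: s_def)
  have s1: "s \<le> 1"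
  proof -
    have "s \<le> b * (norm v * norm w)"
      unfolding s_def h_def by (intro mult_left_mono norm_herm_le b)
    also have "\<dots> = sqrt d * norm w" using b(2) by (simp flip: mult.assoc)
    also have "\<dots> \<le> 1 * 1" using w d by (intro mult_mono) auto
    finally show ?thesis by simp
  qed
  \<comment> \<open>Normalization costs little: \<open>L \<le> 1 + s\<close> preserves the bound
    \<open>1 - d\<close> for \<open>herm w \<xi>\<close>, while \<open>L \<le> 2\<close> loses a
    factor 2 in \<open>herm v \<xi>\<close>.\<close>
  define L where "L = norm \<xi>\<^sub>0"
  have L2: "L\<^sup>2 = 1 + 2 * s" by (simp add: L_def n0)
  have "L \<noteq> 0" using L2 s0 by auto
  then have L0: "0 < L" by (simp add: L_def)
  have L1: "L \<le> 1 + s"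
    by (rule power2_le_imp_le) (use L2 s0 in \<open>auto simp: power2_eq_square algebra_simps\<close>)
  have L3: "L \<le> 2" using L1 s1 by simp
  define \<xi> where "\<xi> = of_real (1 / L) *s \<xi>\<^sub>0"
  have \<xi>: "\<xi> \<in> sphere 0 1" using L0 by (simp add: \<xi>_def norm_divide L_def)
  have nw: "1 - d \<le> cmod (herm w \<xi>)"
  proof -
    have "(1 - d) * L \<le> (1 - d) * (1 + s)" using L1 d by (intro mult_left_mono) auto
    also have "\<dots> \<le> 1 - d + s" using d s0 by (simp add: algebra_simps)
    finally have "1 - d \<le> (1 - d + s) / L" using L0 by (simp add: field_simps)
    also have "\<dots> = cmod (herm w \<xi>)"
      using L0 d s0 by (simp add: \<xi>_def herm_scaleC_right hw norm_mult norm_divide del: of_real_add of_real_diff)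
    finally show ?thesis .
  qed
  have nv: "d * N / 2 \<le> cmod (herm v \<xi>)"
  proof -
    have "d * N \<le> cmod h + sqrt d * norm v"
    proof (rule power2_le_imp_le)
      have "(d * N)\<^sup>2 = d * (norm v)\<^sup>2 + (cmod h)\<^sup>2"
        unfolding d_def N_def h_def by (rule berg_norm_sq[OF w])
      also have "\<dots> \<le> (cmod h + sqrt d * norm v)\<^sup>2"
        using d by (simp add: power2_sum power_mult_distrib)
      finally show "(d * N)\<^sup>2 \<le> (cmod h + sqrt d * norm v)\<^sup>2" .
    qed (use d in auto)
    then have "d * N / 2 \<le> (cmod h + sqrt d * norm v) / 2" by (rule divide_right_mono) simp
    also have "\<dots> \<le> (cmod h + sqrt d * norm v) / L"
      using L0 L3 d by (intro divide_left_mono) auto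
    also have "\<dots> = cmod (herm v \<xi>)"
      using L0 d e(1) by (simp add: \<xi>_def herm_scaleC_right hv norm_mult norm_divide del: of_real_add)
    finally show ?thesis .
  qed
  \<comment> \<open>With this \<open>m\<close>, \<open>m * d \<le> 1/2\<close>, so Bernoulli gives
    \<open>(1 - d) ^ m \<ge> 1/2\<close>, while \<open>Suc m * d \<ge> 1/2\<close>. The exponent is
    \<open>Suc m\<close>, hence at least 1 even if \<open>m = 0\<close>. The remaining 1/2 in the
    constant 1/8 comes from normalizing \<open>\<xi>\<^sub>0\<close>.\<close>
  define m where "m = nat \<lfloor>1 / (2 * d)\<rfloor>"
  have m: "real m \<le> 1 / (2 * d)" "1 / (2 * d) < real m + 1"
    using d unfolding m_def by (auto simp: of_nat_floor)
  have "m * d \<le> 1 / 2" using m(1) d by (simp add: field_simps)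
  moreover have "1 + real m * (- d) \<le> (1 + (- d)) ^ m" using d by (intro Bernoulli_inequality) auto
  ultimately have p: "1 / 2 \<le> (1 - d) ^ m" by simp
  have kd: "1 / 2 \<le> real (Suc m) * d" using m(2) d by (simp add: field_simps)
  have "N / 8 = (1 / 2) * (1 / 2) * (N / 2)" by simp
  also have "\<dots> \<le> (real (Suc m) * d) * (1 - d) ^ m * (N / 2)"
    using kd p d N0 by (intro mult_mono) auto
  also have "\<dots> = real (Suc m) * (1 - d) ^ m * (d * N / 2)" by (simp add: algebra_simps)
  also have "\<dots> \<le> real (Suc m) * cmod (herm w \<xi>) ^ m * cmod (herm v \<xi>)"
    using nw nv d N0 by (intro mult_mono power_mono) auto
  also have "\<dots> = cmod (cdiff (\<lambda>z. herm z \<xi> ^ Suc m) w v)"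
    by (simp add: cdiff_herm_power norm_mult norm_power del: of_nat_Suc power_Suc)
  finally have "Q * (N / 8) \<le> Q * cmod (cdiff (\<lambda>z. herm z \<xi> ^ Suc m) w v)"
    using Q by (rule mult_left_mono)
  also have "\<dots> \<le> C" using \<xi> by (intro bd) auto
  finally show ?thesis by (simp add: N_def)
qed

subsection \<open>Automorphisms of the ball\<close>

text \<open>
  With \<open>s = sqrt (1 - \<bar>a\<bar>\<^sup>2)\<close> one has \<open>P\<^sub>a z + s Q\<^sub>a z = c \<langle>z,a\<rangle> a + s z\<close> for \<open>c = (1 - s)/\<bar>a\<bar>\<^sup>2\<close>. Since \<open>c = 0\<close> for
  \<open>a = 0\<close> by the convention for division, the resulting formula also covers \<open>\<phi>\<^sub>0(z) = -z\<close>.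
\<close>

definition aut_coeff :: "complex ^ 'n \<Rightarrow> real" where
  "aut_coeff a = (1 - sqrt (1 - (norm a)\<^sup>2)) / (norm a)\<^sup>2"

lemma ball_aut_eq:
  "ball_aut a z = (1 / (1 - herm z a)) *s
     (a - (of_real (aut_coeff a) * herm z a) *s a - of_real (sqrt (1 - (norm a)\<^sup>2)) *s z)"
proof (cases "a = 0")
  case True
  then show ?thesis by (simp add: ball_aut_def herm_def vec_eq_iff)
next
  case False
  then have "a - ball_proj a z - of_real (sqrt (1 - (norm a)\<^sup>2)) *s (z - ball_proj a z) =
      a - (of_real (aut_coeff a) * herm z a) *s a - of_real (sqrt (1 - (norm a)\<^sup>2)) *s z"
    unfolding vec_eq_iff by (simp add: ball_proj_def aut_coeff_def diff_divide_distrib algebra_simps)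
  with False show ?thesis by (simp only: ball_aut_def scaleC_of_real if_False)
qed

text \<open>For \<open>a \<noteq> 0\<close> the vector is \<open>P z + s Q z\<close> with
  \<open>P\<close>, \<open>Q\<close> the orthogonal projections attached to \<open>a\<close>. Its
  squared length enters the norm of the automorphism and, at a tangent vector, is the numerator
  under the root in \<open>berg_norm\<close>.\<close>

lemma norm_combination_sq:
  assumes "a \<in> ball 0 1"
  shows "(norm ((of_real (aut_coeff a) * herm z a) *s a + of_real (sqrt (1 - (norm a)\<^sup>2)) *s z))\<^sup>2 =
    (cmod (herm z a))\<^sup>2 + (1 - (norm a)\<^sup>2) * (norm z)\<^sup>2"
proof -
  define s where "s = sqrt (1 - (norm a)\<^sup>2)"
  define \<kappa> where "\<kappa> = aut_coeff a"
  define q where "q = (cmod (herm z a))\<^sup>2"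
  have qq: "of_real q = herm z a * cnj (herm z a)"
    unfolding q_def by (rule complex_norm_square)
  have s: "s\<^sup>2 = 1 - (norm a)\<^sup>2" using one_minus_norm_sq_pos[OF assms] by (simp add: s_def)
  \<comment> \<open>The factor \<open>q\<close> covers \<open>a = 0\<close>, where
    \<open>\<kappa>\<close> is 0 by the division convention but \<open>q\<close> vanishes
    too.\<close>
  have k: "\<kappa> * (1 + s) * q = q"
  proof (cases "a = 0")
    case True then show ?thesis by (simp add: q_def herm_def)
  next
    case False
    have "\<kappa> * (1 + s) = (1 - s\<^sup>2) / (norm a)\<^sup>2"
      by (simp add: \<kappa>_def aut_coeff_def s_def algebra_simps power2_eq_square)
    then show ?thesis using False s by simp
  qed
  have ka: "\<kappa> * (norm a)\<^sup>2 = 1 - s"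
    by (cases "a = 0") (auto simp: \<kappa>_def aut_coeff_def s_def)
  have "herm ((of_real \<kappa> * herm z a) *s a) (of_real s *s z) = of_real (\<kappa> * s * q)"
    by (simp add: herm_scaleC_left herm_scaleC_right herm_commute[of a z] qq mult_ac)
  then have "(norm ((of_real \<kappa> * herm z a) *s a + of_real s *s z))\<^sup>2 =
      \<kappa> * (\<kappa> * (norm a)\<^sup>2) * q + 2 * (\<kappa> * s * q) + s\<^sup>2 * (norm z)\<^sup>2"
    unfolding norm_add_sq by (simp add: norm_mult power_mult_distrib q_def power2_eq_square[of \<kappa>] mult_ac)
  also have "\<dots> = \<kappa> * (1 + s) * q + s\<^sup>2 * (norm z)\<^sup>2"
    unfolding ka by (simp add: algebra_simps)
  finally show ?thesis unfolding k s unfolding q_def s_def \<kappa>_def .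
qed

lemma herm_ne_one:
  assumes "a \<in> ball 0 1" "z \<in> ball 0 1"
  shows "herm z a \<noteq> 1"
proof
  assume "herm z a = 1"
  moreover have "norm z * norm a < 1" using assms mult_strict_mono'[of "norm z" 1 "norm a" 1] by simp
  ultimately show False using norm_herm_le[of z a] by simp
qed

text \<open>Behind this is the classical identity \<open>1 - |\<phi>_a(z)|^2 = (1 - |a|^2) (1 -
  |z|^2) / |1 - <z,a>|^2\<close>.\<close>

lemma norm_ball_aut_le:
  assumes a: "a \<in> ball 0 1" and z: "z \<in> ball 0 1"
  shows "norm (ball_aut a z) \<le> 1"
proof -
  define b where "b = (of_real (aut_coeff a) * herm z a) *s a + of_real (sqrt (1 - (norm a)\<^sup>2)) *s z"
  have ca: "aut_coeff a * (norm a)\<^sup>2 + sqrt (1 - (norm a)\<^sup>2) = 1"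
    by (cases "a = 0") (auto simp: aut_coeff_def)
  have "herm b a = of_real (aut_coeff a * (norm a)\<^sup>2 + sqrt (1 - (norm a)\<^sup>2)) * herm z a"
    by (simp add: b_def herm_add_left herm_scaleC_left herm_self algebra_simps)
  \<comment> \<open>The vectors \<open>b\<close> and \<open>z\<close> have the same component along
    \<open>a\<close>; only the orthogonal part is rescaled.\<close>
  then have ba: "herm b a = herm z a" unfolding ca by simp
  have n1: "(cmod (1 - herm z a))\<^sup>2 = 1 - 2 * Re (herm z a) + (cmod (herm z a))\<^sup>2"
    unfolding cmod_power2 by (simp add: power2_eq_square algebra_simps)
  have "(norm (a + - b))\<^sup>2 = (norm a)\<^sup>2 + 2 * Re (herm a (- b)) + (norm (- b))\<^sup>2"
    by (rule norm_add_sq)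
  also have "Re (herm a (- b)) = - Re (herm b a)"
    by (simp add: herm_def sum_negf Re_sum mult.commute)
  also have "(norm (- b))\<^sup>2 = (cmod (herm z a))\<^sup>2 + (1 - (norm a)\<^sup>2) * (norm z)\<^sup>2"
    unfolding norm_minus_cancel b_def by (rule norm_combination_sq[OF a])
  also have "(norm a)\<^sup>2 + 2 * - Re (herm b a) + ((cmod (herm z a))\<^sup>2 + (1 - (norm a)\<^sup>2) * (norm z)\<^sup>2) =
      (cmod (1 - herm z a))\<^sup>2 - (1 - (norm a)\<^sup>2) * (1 - (norm z)\<^sup>2)"
    by (simp add: ba n1 algebra_simps)
  also have "\<dots> \<le> (cmod (1 - herm z a))\<^sup>2"
    using one_minus_norm_sq_pos[OF a] one_minus_norm_sq_pos[OF z] by simp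
  finally have "norm (a + - b) \<le> cmod (1 - herm z a)" by (rule power2_le_imp_le) simp
  moreover have "ball_aut a z = (1 / (1 - herm z a)) *s (a + - b)"
    by (simp add: ball_aut_eq b_def algebra_simps)
  then have "norm (ball_aut a z) = norm (a + - b) / cmod (1 - herm z a)"
    by (simp only: norm_scaleC norm_divide norm_one times_divide_eq_left mult_1_left)
  ultimately show ?thesis
    using herm_ne_one[OF a z] by (simp add: divide_le_eq)
qed

text \<open>The numerator \<open>g\<close> vanishes at \<open>a\<close>, so the product rule leaves
  only \<open>f a\<close> times the differential of \<open>g\<close>.\<close>

lemma
  assumes a: "a \<in> ball 0 1"
  shows mholomorphic_on_ball_aut: "mholomorphic_on (\<lambda>z. ball_aut a z $ i) (ball 0 1)"
    and cdiff_ball_aut: "cdiff (\<lambda>z. ball_aut a z $ i) a v =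
      - (((of_real (aut_coeff a) * herm v a) *s a + of_real (sqrt (1 - (norm a)\<^sup>2)) *s v) $ i)
        / of_real (1 - (norm a)\<^sup>2)"
proof -
  define k where "k = complex_of_real (aut_coeff a)"
  define s where "s = complex_of_real (sqrt (1 - (norm a)\<^sup>2))"
  define f where "f z = 1 / (1 - herm z a)" for z
  define g where "g z = (a $ i + herm z a * (- k * a $ i)) + z $ i * (- s)" for z
  have eq: "(\<lambda>z. ball_aut a z $ i) = (\<lambda>z. f z * g z)"
    by (simp add: fun_eq_iff ball_aut_eq f_def g_def k_def s_def algebra_simps)
  have d: "((\<lambda>x. 1 / (1 - x)) has_field_derivative 1 / (1 - herm z a)\<^sup>2) (at (herm z a))"
    if "z \<in> ball 0 1" for z
    using herm_ne_one[OF a that] by (auto intro!: derivative_eq_intros simp: power2_eq_square)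
  have f: "mholomorphic_on f (ball 0 1)"
    unfolding f_def
    using cdiff_compose_field(1,2)[OF mholomorphic_on_herm _ d] by (intro mholomorphic_onI) blast
  have g1: "mholomorphic_on (\<lambda>z. a $ i + herm z a * (- k * a $ i)) S"
    and g2: "mholomorphic_on (\<lambda>z. z $ i * (- s)) S" for S
    by (intro mholomorphic_on_add mholomorphic_on_mult mholomorphic_on_herm mholomorphic_on_nth
        mholomorphic_on_const)+
  have g: "mholomorphic_on g (ball 0 1)"
    unfolding g_def by (intro mholomorphic_on_add g1 g2)
  show "mholomorphic_on (\<lambda>z. ball_aut a z $ i) (ball 0 1)"
    unfolding eq by (intro mholomorphic_on_mult f g)
  have ca: "aut_coeff a * (norm a)\<^sup>2 + sqrt (1 - (norm a)\<^sup>2) = 1"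
    by (cases "a = 0") (auto simp: aut_coeff_def)
  have "g a = a $ i * (1 - of_real (aut_coeff a * (norm a)\<^sup>2 + sqrt (1 - (norm a)\<^sup>2)))"
    by (simp add: g_def k_def s_def herm_self algebra_simps)
  then have "g a = 0" unfolding ca by simp
  moreover have "(g has_derivative (\<lambda>v. 0 + herm v a * (- k * a $ i) + v $ i * (- s))) (at a)"
    unfolding g_def
    by (intro has_derivative_add has_derivative_const has_derivative_mult_left
        bounded_linear_imp_has_derivative bounded_linear_herm_left bounded_linear_vec_nth)
  then have "cdiff g a = (\<lambda>v. 0 + herm v a * (- k * a $ i) + v $ i * (- s))"
    by (rule cdiff_unique) (simp add: clinear_form_def herm_scaleC_left algebra_simps)
  ultimately show "cdiff (\<lambda>z. ball_aut a z $ i) a v =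
      - (((of_real (aut_coeff a) * herm v a) *s a + of_real (sqrt (1 - (norm a)\<^sup>2)) *s v) $ i)
        / of_real (1 - (norm a)\<^sup>2)"
    unfolding eq cdiff_mult(2)[OF f g a]
    by (simp add: f_def herm_self k_def s_def field_simps)
qed

text \<open>The differential of the automorphism at its own centre has length exactly
  \<open>berg_norm a v\<close>; the sum merely dominates this Euclidean length.\<close>

lemma berg_norm_le_cdiff_ball_aut:
  fixes a v :: "complex ^ 'n"
  assumes a: "a \<in> ball 0 1"
  shows "berg_norm a v \<le> (\<Sum>i\<in>UNIV. cmod (cdiff (\<lambda>z. ball_aut a z $ i) a v))"
proof -
  define b where "b = (of_real (aut_coeff a) * herm v a) *s a + of_real (sqrt (1 - (norm a)\<^sup>2)) *s v"
  have d: "0 < 1 - (norm a)\<^sup>2" by (rule one_minus_norm_sq_pos[OF a])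
  have "berg_norm a v = norm b / (1 - (norm a)\<^sup>2)"
    unfolding berg_norm_def b_def
    by (simp add: add.commute flip: norm_combination_sq[OF a])
  also have "\<dots> \<le> (\<Sum>i\<in>UNIV. cmod (b $ i)) / (1 - (norm a)\<^sup>2)"
    using d by (intro divide_right_mono) (auto simp: norm_vec_def intro: L2_set_le_sum)
  also have "\<dots> = (\<Sum>i\<in>UNIV. cmod (b $ i) / (1 - (norm a)\<^sup>2))" by (rule sum_divide_distrib)
  also have "\<dots> = (\<Sum>i\<in>UNIV. cmod (cdiff (\<lambda>z. ball_aut a z $ i) a v))"
    unfolding cdiff_ball_aut[OF a] b_def[symmetric] norm_divide norm_minus_cancel
    using d by (simp only: norm_of_real abs_of_pos)
  finally show ?thesis .
qed

subsection \<open>Boundedness of the weighted composition operator\<close>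

lemma SUP_ennreal_finite_iff:
  fixes F :: "'a \<Rightarrow> ennreal"
  shows "(SUP x\<in>A. F x) < \<infinity> \<longleftrightarrow> (\<exists>C\<ge>0. \<forall>x\<in>A. F x \<le> ennreal C)"
proof
  assume fin: "(SUP x\<in>A. F x) < \<infinity>"
  show "\<exists>C\<ge>0. \<forall>x\<in>A. F x \<le> ennreal C"
  proof (intro exI[of _ "enn2real (SUP x\<in>A. F x)"] conjI ballI)
    fix x assume "x \<in> A"
    then have "F x \<le> (SUP x\<in>A. F x)" by (rule SUP_upper)
    then show "F x \<le> ennreal (enn2real (SUP x\<in>A. F x))" using fin by simp
  qed simp
next
  assume "\<exists>C\<ge>0. \<forall>x\<in>A. F x \<le> ennreal C"
  then obtain C where "\<forall>x\<in>A. F x \<le> ennreal C" by blast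
  then have "(SUP x\<in>A. F x) \<le> ennreal C" by (simp add: SUP_le_iff)
  then show "(SUP x\<in>A. F x) < \<infinity>" by (rule le_less_trans) simp
qed

lemma SUP2_ennreal_finite_iff:
  fixes F :: "'a \<Rightarrow> 'b \<Rightarrow> ennreal"
  shows "(SUP x\<in>A. SUP y\<in>B. F x y) < \<infinity> \<longleftrightarrow> (\<exists>C\<ge>0. \<forall>x\<in>A. \<forall>y\<in>B. F x y \<le> ennreal C)"
  unfolding SUP_ennreal_finite_iff SUP_le_iff ..

lemma bloch_seminorm_le_iff:
  "0 \<le> C \<Longrightarrow> bloch_seminorm f \<le> ennreal C \<longleftrightarrow>
     (\<forall>z\<in>ball 0 1. (1 - (norm z)\<^sup>2) * cmod (radial_deriv f z) \<le> C)"
  by (simp add: bloch_seminorm_def SUP_le_iff)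

lemma bloch_seminorm_finite_iff:
  "bloch_seminorm f < \<infinity> \<longleftrightarrow> (\<exists>C\<ge>0. \<forall>z\<in>ball 0 1. (1 - (norm z)\<^sup>2) * cmod (radial_deriv f z) \<le> C)"
  unfolding bloch_seminorm_def SUP_ennreal_finite_iff
  by (intro ex_cong1 conj_cong ball_cong refl ennreal_le_iff)

lemma cjacobian_mult: "cjacobian \<phi> z *v z = (\<chi> i. cdiff (\<lambda>x. \<phi> x $ i) z z)"
  by (simp add: vec_eq_iff cjacobian_def matrix_vector_mult_def cdiff_def)

section \<open>Reduction of all conditions to one metric bound through test functions\<close>

context
  fixes u :: "complex ^ 'n \<Rightarrow> complex" and \<phi> :: "complex ^ 'n \<Rightarrow> complex ^ 'n"
  assumes u_holo: "mholomorphic_on u (ball 0 1)"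
    and phi_holo: "\<And>i. mholomorphic_on (\<lambda>z. \<phi> z $ i) (ball 0 1)"
    and phi_ball: "\<phi> ` ball 0 1 \<subseteq> ball 0 1"
begin

lemma radial_deriv_compose:
  assumes f: "mholomorphic_on f (ball 0 1)" and z: "z \<in> ball 0 1"
  shows "radial_deriv (\<lambda>z. f (\<phi> z)) z = cdiff f (\<phi> z) (cjacobian \<phi> z *v z)"
proof -
  have "\<phi> z \<in> ball 0 1" using phi_ball z by blast
  then show ?thesis
    by (simp only: radial_deriv_eq_cdiff cdiff_compose(3)[OF phi_holo f z] cjacobian_mult)
qed

lemma mholomorphic_on_wcomp:
  "mholomorphic_on f (ball 0 1) \<Longrightarrow> mholomorphic_on (wcomp u \<phi> f) (ball 0 1)"
  unfolding wcomp_def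
  by (intro mholomorphic_on_mult u_holo mholomorphic_on_compose[OF phi_holo _ phi_ball])

lemma radial_deriv_wcomp:
  assumes f: "mholomorphic_on f (ball 0 1)" and z: "z \<in> ball 0 1"
  shows "radial_deriv (wcomp u \<phi> f) z =
    u z * cdiff f (\<phi> z) (cjacobian \<phi> z *v z) + radial_deriv u z * f (\<phi> z)"
  unfolding wcomp_def
  using cdiff_mult(2)[OF u_holo mholomorphic_on_compose[OF phi_holo f phi_ball] z]
    radial_deriv_compose[OF f z]
  by (simp add: radial_deriv_eq_cdiff)

definition Hinf_unit_ball :: "(complex ^ 'n \<Rightarrow> complex) set" where
  "Hinf_unit_ball = {f. mholomorphic_on f (ball 0 1) \<and> (\<forall>x\<in>ball 0 1. cmod (f x) \<le> 1)}"

text \<open>This keeps the product-rule term in which the derivative falls on \<open>f\<close>; the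
  other term is controlled by the Bloch seminorm of \<open>u\<close>.\<close>

definition test_bounded :: "(complex ^ 'n \<Rightarrow> complex) set \<Rightarrow> bool" where
  "test_bounded F \<longleftrightarrow> (\<exists>C\<ge>0. \<forall>f\<in>F. \<forall>z\<in>ball 0 1.
     (1 - (norm z)\<^sup>2) * cmod (u z * cdiff f (\<phi> z) (cjacobian \<phi> z *v z)) \<le> C)"

definition metric_bounded :: bool where
  "metric_bounded \<longleftrightarrow> (\<exists>C\<ge>0. \<forall>z\<in>ball 0 1.
     (1 - (norm z)\<^sup>2) * cmod (u z) * berg_norm (\<phi> z) (cjacobian \<phi> z *v z) \<le> C)"

text \<open>For \<open>f\<close> bounded by 1 the two weighted quantities differ by at most the
  Bloch bound \<open>D\<close> of \<open>u\<close>, so uniform bounds transfer both ways.\<close>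

lemma test_bounded_iff_wcomp:
  assumes ub: "u \<in> bloch_space" and F: "F \<subseteq> Hinf_unit_ball"
  shows "test_bounded F \<longleftrightarrow> (\<exists>C\<ge>0. \<forall>f\<in>F. bloch_seminorm (wcomp u \<phi> f) \<le> ennreal C)"
proof -
  obtain D where D: "0 \<le> D" "\<forall>z\<in>ball 0 1. (1 - (norm z)\<^sup>2) * cmod (radial_deriv u z) \<le> D"
    using ub unfolding bloch_space_def mem_Collect_eq bloch_seminorm_finite_iff by blast
  have near: "\<bar>(1 - (norm z)\<^sup>2) * cmod (radial_deriv (wcomp u \<phi> f) z) -
      (1 - (norm z)\<^sup>2) * cmod (u z * cdiff f (\<phi> z) (cjacobian \<phi> z *v z))\<bar> \<le> D"
    if f: "f \<in> F" and z: "z \<in> ball 0 1" for f z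
  proof -
    have fh: "mholomorphic_on f (ball 0 1)" and f1: "\<forall>x\<in>ball 0 1. cmod (f x) \<le> 1"
      using F f by (auto simp: Hinf_unit_ball_def)
    have \<phi>z: "\<phi> z \<in> ball 0 1" using phi_ball z by blast
    define d where "d = 1 - (norm z)\<^sup>2"
    have d: "0 < d" unfolding d_def by (rule one_minus_norm_sq_pos[OF z])
    let ?a = "u z * cdiff f (\<phi> z) (cjacobian \<phi> z *v z)" and ?b = "radial_deriv u z * f (\<phi> z)"
    have "\<bar>d * cmod (?a + ?b) - d * cmod ?a\<bar> = d * \<bar>cmod (?a + ?b) - cmod ?a\<bar>"
      using d by (simp add: abs_mult flip: right_diff_distrib)
    also have "\<dots> \<le> d * cmod ?b"
      using d norm_triangle_ineq3[of "?a + ?b" ?a] by (intro mult_left_mono) auto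
    also have "\<dots> \<le> d * (cmod (radial_deriv u z) * 1)"
      using d f1[rule_format, OF \<phi>z] unfolding norm_mult by (intro mult_left_mono) auto
    also have "\<dots> \<le> D" using D(2) z by (simp add: d_def)
    finally show ?thesis unfolding radial_deriv_wcomp[OF fh z] d_def .
  qed
  show ?thesis
  proof
    assume "test_bounded F"
    then obtain C where C: "0 \<le> C" "\<And>f z. f \<in> F \<Longrightarrow> z \<in> ball 0 1 \<Longrightarrow>
      (1 - (norm z)\<^sup>2) * cmod (u z * cdiff f (\<phi> z) (cjacobian \<phi> z *v z)) \<le> C"
      unfolding test_bounded_def by blast
    have "bloch_seminorm (wcomp u \<phi> f) \<le> ennreal (C + D)" if f: "f \<in> F" for f
    proof (subst bloch_seminorm_le_iff)
      show "\<forall>z\<in>ball 0 1. (1 - (norm z)\<^sup>2) * cmod (radial_deriv (wcomp u \<phi> f) z) \<le> C + D"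
      proof
        fix z :: "complex ^ 'n" assume z: "z \<in> ball 0 1"
        from near[OF f z] C(2)[OF f z]
        show "(1 - (norm z)\<^sup>2) * cmod (radial_deriv (wcomp u \<phi> f) z) \<le> C + D"
          unfolding abs_le_iff by linarith
      qed
    qed (use C(1) D(1) in simp)
    then show "\<exists>C\<ge>0. \<forall>f\<in>F. bloch_seminorm (wcomp u \<phi> f) \<le> ennreal C"
      using C(1) D(1) by (intro exI[of _ "C + D"]) auto
  next
    assume "\<exists>C\<ge>0. \<forall>f\<in>F. bloch_seminorm (wcomp u \<phi> f) \<le> ennreal C"
    then obtain C where C: "0 \<le> C" "\<And>f z. f \<in> F \<Longrightarrow> z \<in> ball 0 1 \<Longrightarrow>
      (1 - (norm z)\<^sup>2) * cmod (radial_deriv (wcomp u \<phi> f) z) \<le> C"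
      by (meson bloch_seminorm_le_iff)
    have "(1 - (norm z)\<^sup>2) * cmod (u z * cdiff f (\<phi> z) (cjacobian \<phi> z *v z)) \<le> C + D"
      if "f \<in> F" "z \<in> ball 0 1" for f z
      using near[OF that] C(2)[OF that] unfolding abs_le_iff by linarith
    then show "test_bounded F"
      unfolding test_bounded_def using C(1) D(1) by (intro exI[of _ "C + D"]) auto
  qed
qed

text \<open>A general bound \<open>K\<close> is kept so that the operator estimate later scales with
  the sup norm of \<open>f\<close>.\<close>

lemma metric_bounded_cdiff_le:
  assumes "mholomorphic_on f (ball 0 1)" "\<And>x. x \<in> ball 0 1 \<Longrightarrow> cmod (f x) \<le> K" "z \<in> ball 0 1"
    and C: "(1 - (norm z)\<^sup>2) * cmod (u z) * berg_norm (\<phi> z) (cjacobian \<phi> z *v z) \<le> C"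
  shows "(1 - (norm z)\<^sup>2) * cmod (u z * cdiff f (\<phi> z) (cjacobian \<phi> z *v z)) \<le> 4 * K * C"
proof -
  have K: "0 \<le> K" using order_trans[OF norm_ge_zero assms(2)[of 0]] by simp
  have "\<phi> z \<in> ball 0 1" using phi_ball assms(3) by blast
  from norm_cdiff_le_berg_norm[OF assms(1,2) this]
  have "cmod (cdiff f (\<phi> z) (cjacobian \<phi> z *v z)) \<le> 4 * K * berg_norm (\<phi> z) (cjacobian \<phi> z *v z)" .
  then have "((1 - (norm z)\<^sup>2) * cmod (u z)) * cmod (cdiff f (\<phi> z) (cjacobian \<phi> z *v z)) \<le>
      ((1 - (norm z)\<^sup>2) * cmod (u z)) * (4 * K * berg_norm (\<phi> z) (cjacobian \<phi> z *v z))"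
    using one_minus_norm_sq_pos[OF assms(3)] by (intro mult_left_mono) auto
  also have "\<dots> = 4 * K * ((1 - (norm z)\<^sup>2) * cmod (u z) * berg_norm (\<phi> z) (cjacobian \<phi> z *v z))"
    by (simp add: mult_ac)
  also have "\<dots> \<le> 4 * K * C" using C K by (intro mult_left_mono) auto
  finally show ?thesis by (simp add: norm_mult mult_ac)
qed

lemma metric_bounded_imp_test_bounded:
  assumes "metric_bounded" and F: "F \<subseteq> Hinf_unit_ball"
  shows "test_bounded F"
proof -
  obtain C where C: "0 \<le> C" "\<forall>z\<in>ball 0 1.
     (1 - (norm z)\<^sup>2) * cmod (u z) * berg_norm (\<phi> z) (cjacobian \<phi> z *v z) \<le> C"
    using assms(1) unfolding metric_bounded_def by blast
  show ?thesis
    unfolding test_bounded_def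
  proof (intro exI[of _ "4 * 1 * C"] conjI ballI metric_bounded_cdiff_le)
    fix f assume "f \<in> F"
    with F show "mholomorphic_on f (ball 0 1)" "\<And>x. x \<in> ball 0 1 \<Longrightarrow> cmod (f x) \<le> 1"
      by (auto simp: Hinf_unit_ball_def)
  qed (use C in auto)
qed

definition herm_powers :: "(complex ^ 'n \<Rightarrow> complex) set" where
  "herm_powers = (\<lambda>(k, \<xi>) x. herm x \<xi> ^ k) ` ({1..} \<times> sphere 0 1)"

definition aut_components :: "(complex ^ 'n \<Rightarrow> complex) set" where
  "aut_components = (\<lambda>(i, w) x. ball_aut (\<phi> w) x $ i) ` (UNIV \<times> ball 0 1)"

lemma Ball_herm_powers:
  "(\<forall>f\<in>herm_powers. P f) \<longleftrightarrow> (\<forall>k\<in>{1..}. \<forall>\<xi>\<in>sphere 0 1. P (\<lambda>x. herm x \<xi> ^ k))"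
  unfolding herm_powers_def by (auto simp del: One_nat_def)

lemma Ball_aut_components:
  "(\<forall>f\<in>aut_components. P f) \<longleftrightarrow> (\<forall>i. \<forall>w\<in>ball 0 1. P (\<lambda>x. ball_aut (\<phi> w) x $ i))"
  unfolding aut_components_def by auto

lemma herm_powers_subset: "herm_powers \<subseteq> Hinf_unit_ball"
proof
  fix f assume "f \<in> herm_powers"
  then obtain k \<xi> where f: "f = (\<lambda>x. herm x \<xi> ^ k)" and \<xi>: "norm \<xi> = 1"
    unfolding herm_powers_def by auto
  have "cmod (f x) \<le> 1" if "x \<in> ball 0 1" for x
  proof -
    have "cmod (herm x \<xi>) \<le> 1" using norm_herm_le[of x \<xi>] \<xi> that by simp
    then show ?thesis by (simp add: f norm_power power_le_one)
  qed
  moreover have "mholomorphic_on f (ball 0 1)"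
    unfolding f by (intro mholomorphic_on_power mholomorphic_on_herm)
  ultimately show "f \<in> Hinf_unit_ball" by (simp add: Hinf_unit_ball_def)
qed

lemma aut_components_subset: "aut_components \<subseteq> Hinf_unit_ball"
proof
  fix f assume "f \<in> aut_components"
  then obtain i w where f: "f = (\<lambda>x. ball_aut (\<phi> w) x $ i)" and w: "w \<in> ball 0 1"
    unfolding aut_components_def by auto
  have \<phi>w: "\<phi> w \<in> ball 0 1" using phi_ball w by blast
  have "cmod (f x) \<le> 1" if "x \<in> ball 0 1" for x
    unfolding f by (rule order_trans[OF Finite_Cartesian_Product.norm_nth_le norm_ball_aut_le[OF \<phi>w that]])
  moreover have "mholomorphic_on f (ball 0 1)"
    unfolding f by (rule mholomorphic_on_ball_aut[OF \<phi>w])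
  ultimately show "f \<in> Hinf_unit_ball" by (simp add: Hinf_unit_ball_def)
qed

text \<open>The lower bound for powers is applied at \<open>\<phi> z\<close> with weight
  \<open>(1 - |z|^2) |u(z)|\<close>, at the cost of a factor 8.\<close>

lemma test_bounded_herm_powers: "test_bounded herm_powers \<longleftrightarrow> metric_bounded"
proof
  assume "test_bounded herm_powers"
  then obtain C where C: "0 \<le> C" "\<And>k \<xi> z. 1 \<le> k \<Longrightarrow> \<xi> \<in> sphere 0 1 \<Longrightarrow> z \<in> ball 0 1 \<Longrightarrow>
     (1 - (norm z)\<^sup>2) * cmod (u z * cdiff (\<lambda>x. herm x \<xi> ^ k) (\<phi> z) (cjacobian \<phi> z *v z)) \<le> C"
    unfolding test_bounded_def Ball_herm_powers by auto
  show metric_bounded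
    unfolding metric_bounded_def
  proof (intro exI[of _ "8 * C"] conjI ballI berg_norm_le_herm_powers)
    fix z :: "complex ^ 'n" assume z: "z \<in> ball 0 1"
    show "\<phi> z \<in> ball 0 1" using phi_ball z by blast
    show "0 \<le> (1 - (norm z)\<^sup>2) * cmod (u z)" using one_minus_norm_sq_pos[OF z] by simp
    show "(1 - (norm z)\<^sup>2) * cmod (u z) * cmod (cdiff (\<lambda>x. herm x \<xi> ^ k) (\<phi> z) (cjacobian \<phi> z *v z)) \<le> C"
      if "1 \<le> k" "\<xi> \<in> sphere 0 1" for k \<xi>
      using C(2)[OF that z] by (simp add: norm_mult mult_ac)
  qed (use C in auto)
qed (rule metric_bounded_imp_test_bounded[OF _ herm_powers_subset])

text \<open>On the diagonal \<open>w = z\<close> the automorphism is centred at the point where it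
  is differentiated, so its component derivatives recover the Bergman length; summing them gives the
  factor \<open>CARD('n)\<close>.\<close>

lemma test_bounded_aut_components: "test_bounded aut_components \<longleftrightarrow> metric_bounded"
proof
  assume "test_bounded aut_components"
  then obtain C where C: "0 \<le> C" "\<And>i w z. w \<in> ball 0 1 \<Longrightarrow> z \<in> ball 0 1 \<Longrightarrow>
     (1 - (norm z)\<^sup>2) * cmod (u z * cdiff (\<lambda>x. ball_aut (\<phi> w) x $ i) (\<phi> z) (cjacobian \<phi> z *v z)) \<le> C"
    unfolding test_bounded_def Ball_aut_components by blast
  show metric_bounded
    unfolding metric_bounded_def
  proof (intro exI[of _ "real CARD('n) * C"] conjI ballI)
    fix z :: "complex ^ 'n" assume z: "z \<in> ball 0 1"
    let ?M = "(1 - (norm z)\<^sup>2) * cmod (u z)"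
      and ?c = "\<lambda>i. cmod (cdiff (\<lambda>x. ball_aut (\<phi> z) x $ i) (\<phi> z) (cjacobian \<phi> z *v z))"
    have \<phi>z: "\<phi> z \<in> ball 0 1" using phi_ball z by blast
    have "?M * berg_norm (\<phi> z) (cjacobian \<phi> z *v z) \<le> ?M * (\<Sum>i\<in>UNIV. ?c i)"
      using one_minus_norm_sq_pos[OF z]
      by (intro mult_left_mono berg_norm_le_cdiff_ball_aut[OF \<phi>z]) auto
    also have "\<dots> = (\<Sum>i\<in>UNIV. ?M * ?c i)" by (rule sum_distrib_left)
    also have "\<dots> \<le> (\<Sum>i\<in>(UNIV :: 'n set). C)"
      using C(2)[OF z z] by (intro sum_mono) (simp add: norm_mult mult_ac)
    finally show "?M * berg_norm (\<phi> z) (cjacobian \<phi> z *v z) \<le> real CARD('n) * C" by simp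
  qed (use C in auto)
qed (rule metric_bounded_imp_test_bounded[OF _ aut_components_subset])

lemma wcomp_bounded_iff:
  "bounded_linear_operator Hinf Hinf_norm bloch_space bloch_norm (wcomp u \<phi>) \<longleftrightarrow>
    u \<in> bloch_space \<and> metric_bounded"
proof
  assume T: "bounded_linear_operator Hinf Hinf_norm bloch_space bloch_norm (wcomp u \<phi>)"
  then obtain C where C: "0 \<le> C" "\<And>f. f \<in> Hinf \<Longrightarrow> bloch_norm (wcomp u \<phi> f) \<le> ennreal C * Hinf_norm f"
    and T: "\<And>f. f \<in> Hinf \<Longrightarrow> wcomp u \<phi> f \<in> bloch_space"
    unfolding bounded_linear_operator_def by blast
  \<comment> \<open>The constant function 1 is mapped to \<open>u\<close> itself.\<close>
  have "wcomp u \<phi> (\<lambda>_. 1) \<in> bloch_space"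
    by (rule T) (auto simp: Hinf_def mholomorphic_on_const intro!: boundedI[of _ 1])
  then have u: "u \<in> bloch_space" by (simp add: wcomp_def)
  have "bloch_seminorm (wcomp u \<phi> f) \<le> ennreal C" if f: "f \<in> herm_powers" for f
  proof -
    have f1: "f \<in> Hinf_unit_ball" using f herm_powers_subset by blast
    then have "f \<in> Hinf" by (auto simp: Hinf_unit_ball_def Hinf_def intro!: boundedI[of _ 1])
    have "bloch_seminorm (wcomp u \<phi> f) \<le> bloch_norm (wcomp u \<phi> f)"
      by (simp add: bloch_norm_def)
    also have "\<dots> \<le> ennreal C * Hinf_norm f" by (rule C) fact
    also have "\<dots> \<le> ennreal C * 1"
      using f1 by (intro mult_left_mono)
        (auto simp: Hinf_unit_ball_def Hinf_norm_def SUP_le_iff simp flip: ennreal_1)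
    finally show ?thesis by simp
  qed
  then have "test_bounded herm_powers"
    using C(1) test_bounded_iff_wcomp[OF u herm_powers_subset] by blast
  with u show "u \<in> bloch_space \<and> metric_bounded" by (simp add: test_bounded_herm_powers)
next
  assume A: "u \<in> bloch_space \<and> metric_bounded"
  then obtain D where D: "0 \<le> D" "\<And>z. z \<in> ball 0 1 \<Longrightarrow> (1 - (norm z)\<^sup>2) * cmod (radial_deriv u z) \<le> D"
    unfolding bloch_space_def mem_Collect_eq bloch_seminorm_finite_iff by blast
  obtain C where C: "0 \<le> C" "\<And>z. z \<in> ball 0 1 \<Longrightarrow>
     (1 - (norm z)\<^sup>2) * cmod (u z) * berg_norm (\<phi> z) (cjacobian \<phi> z *v z) \<le> C"
    using A unfolding metric_bounded_def by blast
  \<comment> \<open>In the operator constant, \<open>cmod (u 0)\<close> handles the value at the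
    origin, \<open>4 * C\<close> the Cauchy estimate for the differential of \<open>f\<close>, and
    \<open>D\<close> the derivative of \<open>u\<close>.\<close>
  have main: "wcomp u \<phi> f \<in> bloch_space \<and>
      bloch_norm (wcomp u \<phi> f) \<le> ennreal (cmod (u 0) + (4 * C + D)) * Hinf_norm f"
    if f: "f \<in> Hinf" for f
  proof -
    have fh: "mholomorphic_on f (ball 0 1)" using f by (simp add: Hinf_def)
    define K where "K = enn2real (Hinf_norm f)"
    obtain B where B: "\<forall>x\<in>ball 0 1. cmod (f x) \<le> B"
      using f by (auto simp: Hinf_def bounded_iff)
    then have "Hinf_norm f \<le> ennreal B"
      unfolding Hinf_norm_def by (auto simp: SUP_le_iff intro: ennreal_leI)
    then have "Hinf_norm f < \<infinity>" by (rule le_less_trans) simp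
    then have K: "Hinf_norm f = ennreal K" by (simp add: K_def)
    have K0: "0 \<le> K" by (simp add: K_def)
    have fK: "cmod (f x) \<le> K" if "x \<in> ball 0 1" for x
    proof -
      have "ennreal (cmod (f x)) \<le> Hinf_norm f" unfolding Hinf_norm_def using that by (rule SUP_upper)
      then show ?thesis unfolding K using K0 by simp
    qed
    have "(1 - (norm z)\<^sup>2) * cmod (radial_deriv (wcomp u \<phi> f) z) \<le> (4 * C + D) * K"
      if z: "z \<in> ball 0 1" for z
    proof -
      define d where "d = 1 - (norm z)\<^sup>2"
      have d: "0 < d" unfolding d_def by (rule one_minus_norm_sq_pos[OF z])
      let ?a = "u z * cdiff f (\<phi> z) (cjacobian \<phi> z *v z)" and ?b = "radial_deriv u z * f (\<phi> z)"
      have "\<phi> z \<in> ball 0 1" using phi_ball z by blast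
      have "d * cmod (?a + ?b) \<le> d * cmod ?a + d * cmod ?b"
        using d norm_triangle_ineq[of ?a ?b] by (simp flip: distrib_left)
      also have "d * cmod ?a \<le> 4 * K * C"
        unfolding d_def by (rule metric_bounded_cdiff_le[OF fh fK z C(2)[OF z]])
      also have "d * cmod ?b = (d * cmod (radial_deriv u z)) * cmod (f (\<phi> z))" by (simp add: norm_mult)
      also have "\<dots> \<le> D * K"
        using D(2)[OF z] D(1) fK[OF \<open>\<phi> z \<in> ball 0 1\<close>] unfolding d_def by (intro mult_mono) auto
      finally show ?thesis
        unfolding radial_deriv_wcomp[OF fh z] d_def by (simp add: algebra_simps)
    qed
    then have sn: "bloch_seminorm (wcomp u \<phi> f) \<le> ennreal ((4 * C + D) * K)"
      using C(1) D(1) K0 by (subst bloch_seminorm_le_iff) auto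
    then have "bloch_seminorm (wcomp u \<phi> f) < \<infinity>" by (rule le_less_trans) simp
    then have 1: "wcomp u \<phi> f \<in> bloch_space"
      by (simp add: bloch_space_def mholomorphic_on_wcomp[OF fh])
    have "\<phi> 0 \<in> ball 0 1" by (rule subsetD[OF phi_ball]) simp
    from fK[OF this] have "cmod (wcomp u \<phi> f 0) \<le> cmod (u 0) * K"
      by (simp add: wcomp_def norm_mult mult_left_mono)
    then have "bloch_norm (wcomp u \<phi> f) \<le> ennreal (cmod (u 0) * K) + ennreal ((4 * C + D) * K)"
      unfolding bloch_norm_def using sn by (intro add_mono ennreal_leI)
    also have "\<dots> = ennreal ((cmod (u 0) + (4 * C + D)) * K)"
      using C(1) D(1) K0 by (simp add: distrib_right flip: ennreal_plus)
    also have "\<dots> = ennreal (cmod (u 0) + (4 * C + D)) * Hinf_norm f"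
      unfolding K using C(1) D(1) K0 by (intro ennreal_mult) auto
    finally show ?thesis using 1 by blast
  qed
  show "bounded_linear_operator Hinf Hinf_norm bloch_space bloch_norm (wcomp u \<phi>)"
    unfolding bounded_linear_operator_def
  proof (intro conjI exI[of _ "cmod (u 0) + (4 * C + D)"] ballI allI)
    show "0 \<le> cmod (u 0) + (4 * C + D)" using C(1) D(1) by simp
  qed (use main in \<open>auto simp: wcomp_def algebra_simps\<close>)
qed

section \<open>Translation of the remaining conditions into the metric bound\<close>

lemma herm_powers_bloch_iff:
  "u \<in> bloch_space \<Longrightarrow>
    (SUP k\<in>{1::nat..}. SUP \<xi>\<in>sphere 0 1. bloch_seminorm (\<lambda>z. u z * herm (\<phi> z) \<xi> ^ k)) < \<infinity> \<longleftrightarrow>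
    metric_bounded"
  unfolding test_bounded_herm_powers[symmetric] SUP2_ennreal_finite_iff
  by (simp only: test_bounded_iff_wcomp[OF _ herm_powers_subset] Ball_herm_powers wcomp_def ball_UNIV)

lemma aut_components_bloch_iff:
  "u \<in> bloch_space \<Longrightarrow>
    (SUP i::'n. SUP w\<in>ball 0 1. bloch_seminorm (wcomp u \<phi> (\<lambda>z. ball_aut (\<phi> w) z $ i))) < \<infinity> \<longleftrightarrow>
    metric_bounded"
  unfolding test_bounded_aut_components[symmetric] SUP2_ennreal_finite_iff
  by (simp only: test_bounded_iff_wcomp[OF _ aut_components_subset] Ball_aut_components ball_UNIV)

text \<open>As \<open>R(I_u f) = u R f\<close>, these seminorms are exactly the tested quantities,
  with no error term from a product rule.\<close>

lemma I_op_bloch_iff: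
  "(SUP k\<in>{1::nat..}. SUP \<xi>\<in>sphere 0 1. bloch_seminorm (I_op u (\<lambda>z. herm (\<phi> z) \<xi> ^ k))) < \<infinity> \<longleftrightarrow>
    metric_bounded"
proof -
  have "radial_deriv (I_op u (\<lambda>z. herm (\<phi> z) \<xi> ^ k)) z =
      u z * cdiff (\<lambda>x. herm x \<xi> ^ k) (\<phi> z) (cjacobian \<phi> z *v z)"
    if z: "z \<in> ball 0 1" for k \<xi> z
  proof -
    have f: "mholomorphic_on (\<lambda>x. herm x \<xi> ^ k) (ball 0 1)"
      by (intro mholomorphic_on_power mholomorphic_on_herm)
    show ?thesis
      using radial_deriv_I_op[OF u_holo mholomorphic_on_compose[OF phi_holo f phi_ball] z]
        radial_deriv_compose[OF f z] by simp
  qed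
  then have "bloch_seminorm (I_op u (\<lambda>z. herm (\<phi> z) \<xi> ^ k)) \<le> ennreal C \<longleftrightarrow>
      (\<forall>z\<in>ball 0 1. (1 - (norm z)\<^sup>2) *
        cmod (u z * cdiff (\<lambda>x. herm x \<xi> ^ k) (\<phi> z) (cjacobian \<phi> z *v z)) \<le> C)"
    if "0 \<le> C" for C k \<xi>
    using that by (simp add: bloch_seminorm_le_iff)
  then show ?thesis
    unfolding test_bounded_herm_powers[symmetric] SUP2_ennreal_finite_iff test_bounded_def
      Ball_herm_powers
    by (intro ex_cong1 conj_cong ball_cong refl)
qed

lemma bergman_bounded_iff:
  "(SUP z\<in>ball 0 1.
     ennreal ((1 - (norm z)\<^sup>2) * cmod (u z) * sqrt (bergman (\<phi> z) (cjacobian \<phi> z *v z)))) < \<infinity> \<longleftrightarrow>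
    metric_bounded"
proof -
  define c where "c = sqrt ((real CARD('n) + 1) / 2)"
  have c: "0 < c" by (simp add: c_def)
  have eq: "(1 - (norm z)\<^sup>2) * cmod (u z) * sqrt (bergman (\<phi> z) (cjacobian \<phi> z *v z)) =
      c * ((1 - (norm z)\<^sup>2) * cmod (u z) * berg_norm (\<phi> z) (cjacobian \<phi> z *v z))"
    if "z \<in> ball 0 1" for z
  proof -
    have "\<phi> z \<in> ball 0 1" using phi_ball that by blast
    then show ?thesis by (simp add: sqrt_bergman c_def)
  qed
  let ?P = "\<lambda>z. (1 - (norm z)\<^sup>2) * cmod (u z) * berg_norm (\<phi> z) (cjacobian \<phi> z *v z)"
  have "(\<exists>C\<ge>0. \<forall>z\<in>ball 0 1. c * ?P z \<le> C) \<longleftrightarrow> (\<exists>C\<ge>0. \<forall>z\<in>ball 0 1. ?P z \<le> C)"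
  proof
    assume "\<exists>C\<ge>0. \<forall>z\<in>ball 0 1. c * ?P z \<le> C"
    then obtain C where "0 \<le> C" "\<forall>z\<in>ball 0 1. c * ?P z \<le> C" by blast
    then show "\<exists>C\<ge>0. \<forall>z\<in>ball 0 1. ?P z \<le> C"
      using c by (intro exI[of _ "C / c"]) (simp add: pos_le_divide_eq mult.commute[of c])
  next
    assume "\<exists>C\<ge>0. \<forall>z\<in>ball 0 1. ?P z \<le> C"
    then obtain C where "0 \<le> C" "\<forall>z\<in>ball 0 1. ?P z \<le> C" by blast
    then show "\<exists>C\<ge>0. \<forall>z\<in>ball 0 1. c * ?P z \<le> C"
      using c by (intro exI[of _ "c * C"]) (auto intro: mult_left_mono)
  qed
  moreover have "(SUP z\<in>ball 0 1.
      ennreal ((1 - (norm z)\<^sup>2) * cmod (u z) * sqrt (bergman (\<phi> z) (cjacobian \<phi> z *v z)))) < \<infinity> \<longleftrightarrow>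
      (\<exists>C\<ge>0. \<forall>z\<in>ball 0 1. c * ?P z \<le> C)"
    unfolding SUP_ennreal_finite_iff
    by (intro ex_cong1 conj_cong ball_cong refl) (simp only: eq ennreal_le_iff)
  ultimately show ?thesis unfolding metric_bounded_def by (rule trans[rotated])
qed

end

theorem theorem1:
  fixes u :: "complex ^ 'n \<Rightarrow> complex"
    and \<phi> :: "complex ^ 'n \<Rightarrow> complex ^ 'n"
  assumes u_holo: "mholomorphic_on u (ball 0 1)"
    and phi_holo: "\<And>i. mholomorphic_on (\<lambda>z. \<phi> z $ i) (ball 0 1)"
    and phi_ball: "\<phi> ` ball 0 1 \<subseteq> ball 0 1"
  shows
    "(bounded_linear_operator Hinf Hinf_norm bloch_space bloch_norm (wcomp u \<phi>)
        \<longleftrightarrow>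
      u \<in> bloch_space \<and>
      (SUP k\<in>{1::nat..}. SUP \<xi>\<in>sphere 0 1.
         bloch_seminorm (\<lambda>z. u z * herm (\<phi> z) \<xi> ^ k)) < \<infinity>)
     \<and>
     (bounded_linear_operator Hinf Hinf_norm bloch_space bloch_norm (wcomp u \<phi>)
        \<longleftrightarrow>
      u \<in> bloch_space \<and>
      (SUP z\<in>ball 0 1.
         ennreal ((1 - (norm z)\<^sup>2) * cmod (u z) * sqrt (bergman (\<phi> z) (cjacobian \<phi> z *v z)))) < \<infinity>)
     \<and>
     (bounded_linear_operator Hinf Hinf_norm bloch_space bloch_norm (wcomp u \<phi>)
        \<longleftrightarrow>
      u \<in> bloch_space \<and>
      (SUP i::'n. SUP w\<in>ball 0 1.
         bloch_seminorm (wcomp u \<phi> (\<lambda>z. ball_aut (\<phi> w) z $ i))) < \<infinity>)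
     \<and>
     (bounded_linear_operator Hinf Hinf_norm bloch_space bloch_norm (wcomp u \<phi>)
        \<longleftrightarrow>
      u \<in> bloch_space \<and>
      (SUP k\<in>{1::nat..}. SUP \<xi>\<in>sphere 0 1.
         bloch_seminorm (I_op u (\<lambda>z. herm (\<phi> z) \<xi> ^ k))) < \<infinity>)"
  using wcomp_bounded_iff[OF assms] herm_powers_bloch_iff[OF assms] bergman_bounded_iff[OF assms]
    aut_components_bloch_iff[OF assms] I_op_bloch_iff[OF assms]
  by blast

end
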